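(* Let $f:\mathbb{R}^d\to\mathbb{R}$ be continuously differentiable with $\lambda$-Lipschitz first derivative and $\gamma$-strongly convex for some $\gamma>0$, and suppose $f$ attains its minimum $f_*$. Write $f_e(\mathbf{x})=f(\mathbf{x})-f_*$. Let $\mathbf{x}_0\in\mathbb{R}^d$ be an arbitrary initialization. Let $\epsilon\in(0,1)$, $\delta\in(0,1]$, and let $1\le\ell\le d$ be an integer sufficiently large to achieve the desired $\epsilon$ and $\delta$ in the sense that $$1-I_{(1-\epsilon)\ell/d}\big(\ell/2,(d-\ell)/2\big)\ge\delta .$$ Let $(\mathbf{P}_k)_{k\ge0}$ be i.i.d. random matrices distributed as $\sqrt{d/\ell}\;\mathbf{Q}\,\mathbf{I}_{d\times\ell}$, where $\mathbf{Q}$ is a Haar-distributed random $d\times d$ orthogonal matrix and $\mathbf{I}_{d\times\ell}$ consists of the first $\ell$ columns of the $d\times d$ identity matrix. With step-size $\alpha=\ell/(d\lambda)$, define $$\mathbf{x}_{k+1}=\mathbf{x}_k-\alpha\,\mathbf{P}_k\mathbf{P}_k^\top\nabla f(\mathbf{x}_k),\qquad k\ge0.$$ Then for any $t\in(0,\delta]$ (and $k\ge 1$), $$\mathbb{P}\left(f_e(\mathbf{x}_k)\ge\rho^k f_e(\mathbf{x}_0)\right)\le\exp\left(-\frac{(kt)^2}{2\sigma_k^2}\right),\qquad \rho=\left(1-(1-\epsilon)\frac{\ell\gamma}{d\lambda}\right)^{\delta-t},$$ where $$\sigma_k^2=\begin{cases}\dfrac{k(1-2\delta)}{2\log((1-\delta)/\delta)},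 & \delta\in(0,1)\setminus\{1/2\},\\[2mm] k/4, & \delta=1/2,\end{cases}$$ and, when $\delta=1$, $\sigma_k^2=0$ with the right-hand side of the bound interpreted as $0$.
   Context: $I_p(a,b)$ denotes the regularized incomplete Beta function, i.e. the CDF at $p$ of the $\mathrm{Beta}(a,b)$ distribution; when $\ell=d$, $\mathrm{Beta}(d/2,0)$ is understood as the point mass at $1$, so $I_p(d/2,0)=0$ for $p<1$. The left-hand side of the condition on $\ell$ is the probability that $\|\mathbf{P}_k^\top\mathbf{v}\|^2\ge(1-\epsilon)\|\mathbf{v}\|^2$ for a fixed vector $\mathbf{v}$. A differentiable function $f$ is $\gamma$-strongly convex if $f(\mathbf{y})\ge f(\mathbf{x})+\nabla f(\mathbf{x})^\top(\mathbf{y}-\mathbf{x})+\frac{\gamma}{2}\|\mathbf{y}-\mathbf{x}\|^2$ for all $\mathbf{x},\mathbf{y}\in\mathbb{R}^d$ (necessarily $\gamma\le\lambda$), with $\|\cdot\|$ the Euclidean norm.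
   Formalization: The initialization x_0 is assumed not to be a minimizer of f: if f_e(x_0)=0, then x_k=x_0 for all k, the event reads 0≥0 and has probability 1, while the right-hand side is below 1, so the claim fails there. *)

theory Defs
  imports "HOL-Probability.Probability"
begin

text \<open>
  These are the types \<open>real ^ 'n\<close> and \<open>real ^ 'n ^ 'm\<close> (matrices with rows indexed by \<open>'m\<close> and
  columns indexed by \<open>'n\<close>); the \<open>^\<close> notation cannot be used with an index type that carries a
  stronger sort than \<open>finite\<close> unless the sort is repeated at each occurrence.
\<close>

type_synonym 'n rvec = "(real, 'n) vec"
type_synonym ('m, 'n) rmat = "((real, 'n) vec, 'm) vec"

text \<open>
  For \<open>b = 0\<close> the Beta distribution is taken to be its weak limit as \<open>b\<close> tends to \<open>0\<close>, the point
  mass at 1. The definition is meant for \<open>a > 0\<close> and \<open>b \<ge> 0\<close>.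
\<close>

definition beta_distribution :: "real \<Rightarrow> real \<Rightarrow> real measure" where
  "beta_distribution a b =
     (if b = 0 then return borel 1
      else density lborel
        (\<lambda>u. ennreal (indicator {0..1} u * (u powr (a - 1) * (1 - u) powr (b - 1) / Beta a b))))"

definition reg_inc_beta :: "real \<Rightarrow> real \<Rightarrow> real \<Rightarrow> real" where
  "reg_inc_beta p a b = cdf (beta_distribution a b) p"

text \<open>
  The Haar probability measure on the orthogonal group, regarded as a Borel measure on the space
  of all square matrices that is concentrated on the orthogonal ones. Left invariance characterises
  it uniquely; right invariance is a consequence, since the group is compact.
\<close>

definition haar_orthogonal :: "(real ^ 'n ^ 'n) measure \<Rightarrow> bool" where
  "haar_orthogonal \<mu> \<longleftrightarrow>
     prob_space \<mu> \<and> sets \<mu> = sets borel \<and>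
     (AE Q in \<mu>. orthogonal_matrix Q) \<and>
     (\<forall>U. orthogonal_matrix U \<longrightarrow> distr \<mu> borel (\<lambda>Q. U ** Q) = \<mu>)"

text \<open>
  The first \<open>CARD('l)\<close> columns of the identity matrix of size \<open>CARD('d)\<close>, for
  \<open>CARD('l) \<le> CARD('d)\<close>. The number \<open>card {..<i}\<close> is the position of the index \<open>i\<close> in the
  linear order of its (finite) index type, counted from 0.
\<close>

definition id_columns :: "('d::{finite,linorder}, 'l::{finite,linorder}) rmat" where
  "id_columns = (\<chi> i j. if card {..<i} = card {..<j} then 1 else 0)"

text \<open>
  The variance proxy of a centred Bernoulli sum; at \<open>\<delta> = 1\<close> it is set to 0 explicitly, because
  the general formula contains the logarithm of 0 there.
\<close>

definition sigma_sq :: "real \<Rightarrow> nat \<Rightarrow> real" where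
  "sigma_sq \<delta> k =
     (if \<delta> = 1 then 0
      else if \<delta> = 1 / 2 then real k / 4
      else real k * (1 - 2 * \<delta>) / (2 * ln ((1 - \<delta>) / \<delta>)))"

end

theory Submission
  imports Defs
begin

text \<open>
  If \<open>P\<close> has \<open>P\<^sup>T P = (d/l) I\<close>, the descent inequality with step size \<open>l/(d lam)\<close> lowers \<open>f\<close> by at
  least \<open>(\<alpha>/2) |P\<^sup>T g|\<^sup>2\<close>, where \<open>g\<close> is the gradient. So the excess never grows, and when
  \<open>|P\<^sup>T g|\<^sup>2 \<ge> (1 - \<epsilon>) |g|\<^sup>2\<close> strong convexity makes it shrink by the factor
  \<open>c = 1 - (1 - \<epsilon>) l \<gamma>/(d lam)\<close>. Given the past this happens with probability at least \<open>\<delta>\<close>, whence the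
  \<open>r\<close>-th power of the relative excess has expectation at most \<open>(1 - \<delta> + \<delta> c\<^sup>r)\<^sup>k\<close> after \<open>k\<close> steps.
  Markov's inequality and the Kearns--Saul bound on the exponential moments of a Bernoulli variable
  give the tail bound; for \<open>\<delta> = 1\<close> let \<open>r\<close> tend to infinity.

  To find the law of \<open>|P\<^sup>T v|\<^sup>2\<close>, note that left invariance of the Haar measure makes the law of
  \<open>|P\<^sup>T v|\<^sup>2 / |v|\<^sup>2\<close> independent of \<open>v \<noteq> 0\<close>. Averaging over \<open>v\<close> in the unit ball and exchanging
  integrals turns it, since Lebesgue measure is invariant under \<open>Q\<^sup>T\<close>, into the law of the share of
  \<open>l\<close> coordinates in the squared norm of a uniform point of the ball, which is a Beta law.
\<close>

section \<open>Exponential moments of a Bernoulli variable\<close>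

text \<open>The derivative of \<open>sinh y * cosh y - y\<close> is twice the square of
  \<open>sinh y\<close>.\<close>

lemma sinh_times_cosh_ge: "y \<le> sinh y * cosh (y::real)" if "y \<ge> 0"
proof -
  have "sinh 0 * cosh 0 - 0 \<le> sinh y * cosh y - (y::real)"
  proof (rule DERIV_nonneg_imp_nondecreasing[OF that])
    fix x :: real
    have "((\<lambda>y. sinh y * cosh y - y) has_real_derivative (cosh x * cosh x + sinh x * sinh x - 1)) (at x)"
      by (auto intro!: derivative_eq_intros)
    moreover have "cosh x * cosh x + sinh x * sinh x - 1 \<ge> 0"
      using cosh_real_ge_1[of x] by (simp add: cosh_square_eq flip: power2_eq_square)
    ultimately show "\<exists>D. ((\<lambda>y. sinh y * cosh y - y) has_real_derivative D) (at x) \<and> 0 \<le> D"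
      by blast
  qed
  thus ?thesis by simp
qed

text \<open>The derivative has the sign of \<open>z - sinh z * cosh z\<close>. As
  \<open>tanh y / y\<close> is twice the derivative of \<open>ln (cosh y)\<close> in the variable
  \<open>y\<^sup>2\<close>, this is the concavity of \<open>ln cosh\<close> in that
  variable.\<close>

lemma tanh_over_self_antimono: "tanh y / y \<le> tanh x / (x::real)" if "0 < x" "x \<le> y"
proof (rule DERIV_nonpos_imp_nonincreasing[OF that(2)])
  fix z :: real assume "x \<le> z"
  hence z: "z > 0" using that by simp
  have "((\<lambda>y. tanh y / y) has_real_derivative ((1 - tanh z ^ 2) * z - tanh z) / (z * z)) (at z)"
    using z by (auto intro!: derivative_eq_intros)
  moreover have "(1 - tanh z ^ 2) * z - tanh z \<le> 0"
  proof -
    have "1 - (tanh z)\<^sup>2 = 1 / (cosh z)\<^sup>2"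
      using hyperbolic_pythagoras[of z]
      by (simp add: tanh_def power_divide diff_divide_eq_iff del: hyperbolic_pythagoras)
    moreover have "tanh z = sinh z * cosh z / (cosh z)\<^sup>2"
      by (simp add: tanh_def power2_eq_square)
    ultimately have "(1 - tanh z ^ 2) * z - tanh z = (z - sinh z * cosh z) / (cosh z)\<^sup>2"
      by (simp add: diff_divide_distrib)
    also have "\<dots> \<le> 0" using sinh_times_cosh_ge[of z] z by (simp add: divide_nonpos_nonneg)
    finally show ?thesis .
  qed
  ultimately show "\<exists>D. ((\<lambda>y. tanh y / y) has_real_derivative D) (at z) \<and> D \<le> 0"
    using z by (meson divide_nonpos_pos mult_pos_pos)
qed

lemma tanh_real_le: "tanh y \<le> (y::real)" if "y \<ge> 0"
proof -
  have "0 - tanh 0 \<le> y - tanh (y::real)"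
  proof (rule DERIV_nonneg_imp_nondecreasing[OF that])
    fix x :: real
    have "((\<lambda>y. y - tanh y) has_real_derivative (tanh x ^ 2)) (at x)"
      by (auto intro!: derivative_eq_intros)
    thus "\<exists>D. ((\<lambda>y. y - tanh y) has_real_derivative D) (at x) \<and> 0 \<le> D"
      using zero_le_power2 by blast
  qed
  thus ?thesis by simp
qed

lemma ln_cosh_derivative:
  "((\<lambda>x. c * x\<^sup>2 / 2 - ln (cosh x)) has_real_derivative c * x - tanh x) (at (x::real))"
  by (auto intro!: derivative_eq_intros simp: tanh_def)

lemma ln_cosh_le: "ln (cosh y) \<le> y\<^sup>2 / (2::real)"
proof -
  have *: "ln (cosh y) \<le> y\<^sup>2 / 2" if "y \<ge> 0" for y :: real
  proof -
    have "1 * 0\<^sup>2 / 2 - ln (cosh 0) \<le> 1 * y\<^sup>2 / 2 - ln (cosh y)"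
    proof (rule DERIV_nonneg_imp_nondecreasing[OF that])
      fix x :: real assume "0 \<le> x"
      thus "\<exists>D. ((\<lambda>x. 1 * x\<^sup>2 / 2 - ln (cosh x)) has_real_derivative D) (at x) \<and> 0 \<le> D"
        using ln_cosh_derivative[of 1 x] tanh_real_le[of x]
        by (intro exI[of _ "1 * x - tanh x"]) auto
    qed
    thus ?thesis by simp
  qed
  show ?thesis using *[of y] *[of "-y"] by (cases "y \<ge> 0") auto
qed

text \<open>By concavity in the variable \<open>y\<^sup>2\<close>, the graph of
  \<open>ln cosh\<close> lies below its tangent at \<open>m\<^sup>2\<close>, whose slope is
  \<open>tanh m / (2 * m)\<close>.\<close>

lemma ln_cosh_tangent_le:
  fixes m y :: real
  assumes "m \<noteq> 0"
  shows "ln (cosh y) - ln (cosh m) \<le> (y\<^sup>2 - m\<^sup>2) * tanh m / (2 * m)"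
proof -
  have main: "ln (cosh y) - ln (cosh m) \<le> (y\<^sup>2 - m\<^sup>2) * tanh m / (2 * m)"
    if "m > 0" "y \<ge> 0" for m y :: real
  proof -
    \<comment> \<open>Twice the tangent slope, so that
      \<open>c * y\<^sup>2 / 2 - ln (cosh y)\<close> is stationary at \<open>m\<close>; it falls
      before \<open>m\<close> and rises after it.\<close>
    define c where "c = tanh m / m"
    have nonneg: "c * x - tanh x \<ge> 0" if "x \<ge> m" for x
      using tanh_over_self_antimono[of m x] \<open>m > 0\<close> that by (simp add: c_def field_simps)
    have nonpos: "c * x - tanh x \<le> 0" if "0 \<le> x" "x \<le> m" for x
      using tanh_over_self_antimono[of x m] \<open>m > 0\<close> that by (cases "x = 0") (simp_all add: c_def field_simps)
    have "c * m\<^sup>2 / 2 - ln (cosh m) \<le> c * y\<^sup>2 / 2 - ln (cosh y)"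
    proof (cases "m \<le> y")
      case True
      show ?thesis
        by (rule DERIV_nonneg_imp_nondecreasing[OF True]) (use ln_cosh_derivative nonneg in blast)
    next
      case False
      hence "y \<le> m" by simp
      show ?thesis
        by (rule DERIV_nonpos_imp_nonincreasing[OF \<open>y \<le> m\<close>])
          (use ln_cosh_derivative nonpos that(2) in \<open>meson order_trans\<close>)
    qed
    thus ?thesis by (simp add: c_def algebra_simps diff_divide_distrib)
  qed
  \<comment> \<open>Both sides are even in \<open>m\<close> and in \<open>y\<close>, which leaves
    the case settled in \<open>main\<close>.\<close>
  have "\<bar>m\<bar> > 0" using assms by simp
  from main[OF this, of "\<bar>y\<bar>"] show ?thesis
    by (cases "m > 0"; cases "y > 0") (use assms in auto)
qed

text \<open>The numerator \<open>1 - 2 * \<delta>\<close> and the logarithm change sign together at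
  1/2.\<close>

lemma sigma_sq_pos: "sigma_sq \<delta> 1 > 0" if "0 < \<delta>" "\<delta> < 1"
proof -
  consider "\<delta> < 1/2" | "\<delta> = 1/2" | "\<delta> > 1/2" by linarith
  then show ?thesis
  proof cases
    case 1
    hence "ln ((1 - \<delta>) / \<delta>) > 0" using that by simp
    with 1 that show ?thesis by (simp add: sigma_sq_def zero_less_divide_iff)
  next
    case 3
    hence "ln ((1 - \<delta>) / \<delta>) < 0" using that by (simp add: ln_less_zero)
    with 3 that show ?thesis by (simp add: sigma_sq_def zero_less_divide_iff)
  qed (simp add: sigma_sq_def)
qed

lemma sigma_sq_eq: "sigma_sq \<delta> k = real k * sigma_sq \<delta> 1"
  by (simp add: sigma_sq_def)

lemma bernoulli_exp_moment_le:
  fixes \<delta> s :: real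
  assumes "0 < \<delta>" "\<delta> < 1"
  shows "1 - \<delta> + \<delta> * exp s \<le> exp (s * \<delta> + s\<^sup>2 * sigma_sq \<delta> 1 / 2)"
proof -
  \<comment> \<open>With \<open>\<delta> = 1 / (1 + e\<^bsup>2m\<^esup>)\<close> and \<open>y = s / 2 - m\<close> the claim is the tangent bound for \<open>ln cosh\<close>.\<close>
  define m where "m = ln ((1 - \<delta>) / \<delta>) / 2"
  have e2m: "exp m * exp m = (1 - \<delta>) / \<delta>"
    using assms by (simp add: m_def flip: exp_add)
  have exp2m: "exp (2 * m) = (1 - \<delta>) / \<delta>" using e2m by (simp flip: exp_add)
  have d: "\<delta> = 1 / (1 + exp m * exp m)"
    using assms by (simp add: e2m field_simps)
  \<comment> \<open>Through this identity the tangent slope becomes the variance proxy: for nonzero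
    \<open>m\<close>, \<open>sigma_sq \<delta> 1\<close> is \<open>tanh m / (4 * m)\<close>.\<close>
  have tanh: "tanh m = 1 - 2 * \<delta>"
  proof -
    have "exp (- 2 * m) = \<delta> / (1 - \<delta>)"
      using exp_minus[of "2 * m"] unfolding exp2m by simp
    thus ?thesis using assms unfolding tanh_real_altdef by (simp only:) (simp add: field_simps)
  qed
  \<comment> \<open>Over the denominator \<open>1 + exp (2 * m)\<close> the numerator is
    \<open>exp (2 * m) + exp s\<close>; dividing it by the geometric mean of its two terms leaves
    twice a hyperbolic cosine.\<close>
  have "1 - \<delta> + \<delta> * exp s = exp (s / 2) * cosh (s / 2 - m) / cosh m"
  proof -
    define a b where "a = exp (s / 2)" and "b = exp m"
    have pos: "a > 0" "b > 0" by (simp_all add: a_def b_def)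
    have exp_s: "exp s = a * a" by (simp add: a_def flip: exp_add)
    have cosh_s: "cosh (s / 2 - m) = (a / b + b / a) / 2"
      unfolding cosh_field_def by (simp only: a_def b_def flip: exp_diff) simp
    have cosh_m: "cosh m = (b + 1 / b) / 2"
      by (simp add: cosh_field_def b_def exp_minus inverse_eq_divide)
    have "1 + b * b > 0" using pos by (simp add: add_pos_pos)
    hence "1 - 1 / (1 + b * b) + 1 / (1 + b * b) * (a * a) = (a * a + b * b) / (1 + b * b)"
      by (simp add: divide_simps)
    hence "1 - \<delta> + \<delta> * (a * a) = (a * a + b * b) / (1 + b * b)"
      using d unfolding b_def by (simp only:)
    moreover have "a * ((a / b + b / a) / 2) = (a * a + b * b) / (2 * b)"
      using pos by (simp add: field_simps)
    moreover have "(b + 1 / b) / 2 = (1 + b * b) / (2 * b)"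
      using pos by (simp add: field_simps)
    moreover have "x / (2 * b) / (y / (2 * b)) = x / y" for x y :: real
      using pos by simp
    ultimately show ?thesis unfolding a_def[symmetric] exp_s cosh_s cosh_m
      by (simp only:)
  qed
  also have "\<dots> = exp (s / 2 + (ln (cosh (s / 2 - m)) - ln (cosh m)))"
    by (simp add: exp_add exp_diff)
  also have "\<dots> \<le> exp (s * \<delta> + s\<^sup>2 * sigma_sq \<delta> 1 / 2)"
  proof (cases "m = 0")
    \<comment> \<open>Here the slope \<open>tanh m / (2 * m)\<close> would be a division by zero;
      \<open>ln_cosh_le\<close> supplies its limit 1/2.\<close>
    case True
    hence \<delta>: "\<delta> = 1 / 2" by (subst d) simp
    show ?thesis unfolding \<delta>
      using ln_cosh_le[of "s/2"] True by (simp add: sigma_sq_def power2_eq_square)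
  next
    case False
    hence d2: "\<delta> \<noteq> 1/2" unfolding m_def by auto
    hence sg: "sigma_sq \<delta> 1 = tanh m / (4 * m)"
      using assms by (simp add: sigma_sq_def m_def tanh[unfolded m_def])
    have "ln (cosh (s / 2 - m)) - ln (cosh m) \<le> ((s/2 - m)\<^sup>2 - m\<^sup>2) * tanh m / (2 * m)"
      by (rule ln_cosh_tangent_le) fact
    also have "\<dots> = s\<^sup>2 * (tanh m / (4 * m)) / 2 - s * tanh m / 2"
      using False by (simp add: field_simps power2_eq_square)
    finally have "s / 2 + (ln (cosh (s / 2 - m)) - ln (cosh m)) \<le> s / 2 - s * tanh m / 2 + s\<^sup>2 * sigma_sq \<delta> 1 / 2"
      unfolding sg by simp
    also have "s / 2 - s * tanh m / 2 = s * \<delta>" unfolding tanh by (simp add: field_simps)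
    finally show ?thesis by simp
  qed
  finally show ?thesis .
qed

section \<open>Smooth strongly convex functions\<close>

text \<open>Along the segment from \<open>y\<close> to \<open>z\<close>, let \<open>\<phi>\<close>
  be \<open>f\<close> minus the linear and quadratic terms of the bound. Cauchy-Schwarz and the
  Lipschitz condition make its derivative nonpositive, and the claim is
  \<open>\<phi> 1 \<le> \<phi> 0\<close>.\<close>

lemma smooth_descent:
  fixes f :: "'a::real_inner \<Rightarrow> real"
  assumes gradient: "\<And>y. GDERIV f y :> f' y"
    and lip: "lam-lipschitz_on UNIV f'"
  shows "f z \<le> f y + f' y \<bullet> (z - y) + lam / 2 * (norm (z - y))\<^sup>2"
proof -
  define v where "v = z - y"
  define \<phi> where "\<phi> s = f (y + s *\<^sub>R v) - s * (f' y \<bullet> v) - lam / 2 * s\<^sup>2 * (norm v)\<^sup>2" for s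
  have "\<phi> 1 \<le> \<phi> 0"
  proof (rule DERIV_nonpos_imp_nonincreasing[where f=\<phi> and a=0 and b=1])
    fix s :: real assume s: "0 \<le> s"
    have "(f has_derivative (\<lambda>h. h \<bullet> f' (y + s *\<^sub>R v))) (at (y + s *\<^sub>R v))"
      using gradient[of "y + s *\<^sub>R v"] by (simp add: gderiv_def)
    moreover have "((\<lambda>s. y + s *\<^sub>R v) has_derivative (\<lambda>h. h *\<^sub>R v)) (at s)"
      by (auto intro!: derivative_eq_intros)
    ultimately have "((\<lambda>s. f (y + s *\<^sub>R v)) has_derivative (\<lambda>h. (h *\<^sub>R v) \<bullet> f' (y + s *\<^sub>R v))) (at s)"
      using has_derivative_compose by blast
    hence "((\<lambda>s. f (y + s *\<^sub>R v)) has_real_derivative f' (y + s *\<^sub>R v) \<bullet> v) (at s)"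
      by (rule has_derivative_imp_has_field_derivative) (simp add: inner_commute)
    hence "(\<phi> has_real_derivative f' (y + s *\<^sub>R v) \<bullet> v - f' y \<bullet> v - lam * s * (norm v)\<^sup>2) (at s)"
      unfolding \<phi>_def by (auto intro!: derivative_eq_intros)
    moreover have "f' (y + s *\<^sub>R v) \<bullet> v - f' y \<bullet> v - lam * s * (norm v)\<^sup>2 \<le> 0"
    proof -
      have "f' (y + s *\<^sub>R v) \<bullet> v - f' y \<bullet> v = (f' (y + s *\<^sub>R v) - f' y) \<bullet> v"
        by (simp add: inner_diff_left)
      also have "\<dots> \<le> norm (f' (y + s *\<^sub>R v) - f' y) * norm v"
        by (rule norm_cauchy_schwarz)
      also have "\<dots> \<le> (lam * norm (s *\<^sub>R v)) * norm v"
        using lipschitz_onD[OF lip, of "y + s *\<^sub>R v" y]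
        by (intro mult_right_mono) (simp_all add: dist_norm)
      finally show ?thesis using s by (simp add: power2_eq_square mult_ac)
    qed
    ultimately show "\<exists>D. (\<phi> has_real_derivative D) (at s) \<and> D \<le> 0" by blast
  qed simp
  thus ?thesis by (simp add: \<phi>_def v_def)
qed

text \<open>The Polyak-Lojasiewicz inequality when \<open>z\<close> is a minimizer. It comes from
  completing the square in the quadratic lower bound.\<close>

lemma strongly_convex_gradient_dominated:
  fixes f :: "'a::real_inner \<Rightarrow> real"
  assumes "\<gamma> > 0"
    and "\<And>y z. f z \<ge> f y + f' y \<bullet> (z - y) + \<gamma> / 2 * (norm (z - y))\<^sup>2"
  shows "2 * \<gamma> * (f y - f z) \<le> (norm (f' y))\<^sup>2"
proof -
  have "0 \<le> (norm (f' y + \<gamma> *\<^sub>R (z - y)))\<^sup>2" by simp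
  also have "\<dots> = (norm (f' y))\<^sup>2 + 2 * \<gamma> * (f' y \<bullet> (z - y) + \<gamma> / 2 * (norm (z - y))\<^sup>2)"
    unfolding power2_norm_eq_inner inner_add_left inner_add_right
    by (simp add: inner_commute algebra_simps)
  also have "\<dots> \<le> (norm (f' y))\<^sup>2 + 2 * \<gamma> * (f z - f y)"
    using assms by (intro add_left_mono mult_left_mono) (auto simp: algebra_simps)
  finally show ?thesis by (simp add: algebra_simps)
qed

text \<open>The upper and lower quadratic bounds are compared along a unit vector. This is what
  makes \<open>lam\<close> positive and keeps the contraction factor of the main proof
  positive.\<close>

lemma strong_convexity_le_smoothness:
  fixes f :: "'a::euclidean_space \<Rightarrow> real"
  assumes gradient: "\<And>y. GDERIV f y :> f' y"
    and lip: "lam-lipschitz_on UNIV f'"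
    and sc: "\<And>y z. f z \<ge> f y + f' y \<bullet> (z - y) + \<gamma> / 2 * (norm (z - y))\<^sup>2"
  shows "\<gamma> \<le> lam"
proof -
  obtain b :: 'a where "b \<in> Basis" using nonempty_Basis by blast
  thus ?thesis
    using smooth_descent[OF gradient lip, of b 0] sc[of 0 b] by simp
qed

section \<open>The share of some coordinates in the squared norm of a point of the ball\<close>

text \<open>
  A translation-invariant measure \<open>\<nu>\<close> satisfies \<open>\<nu> A \<cdot> lborel B = lborel A \<cdot> \<nu> (-B)\<close>; the ball
  \<open>B\<close> is fixed by \<open>T\<close>. The library has the invariance only for index types of class \<open>wellorder\<close>.
\<close>

lemma lborel_distr_orthogonal:
  fixes T :: "'a::euclidean_space \<Rightarrow> 'a"
  assumes T: "orthogonal_transformation T"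
  shows "distr lborel borel T = lborel"
proof (rule measure_eqI)
  define \<nu> where "\<nu> = distr lborel borel T"
  have lin: "linear T" and norm: "\<And>x. norm (T x) = norm x"
    using T by (auto simp: orthogonal_transformation)
  have [measurable]: "T \<in> borel_measurable borel"
    using lin by (simp add: linear_continuous_on borel_measurable_continuous_onI linear_linear)
  have sets_nu [measurable_cong]: "sets \<nu> = sets borel" by (simp add: \<nu>_def)
  have nu_int: "integral\<^sup>N \<nu> g = (\<integral>\<^sup>+x. g (T x) \<partial>lborel)" if "g \<in> borel_measurable borel" for g
    using that unfolding \<nu>_def by (subst nn_integral_distr) auto
  have shift: "(\<integral>\<^sup>+x. g (c + x) \<partial>lborel) = integral\<^sup>N lborel g"
    if [measurable]: "g \<in> borel_measurable borel" for g and c :: 'a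
    by (subst (2) lborel_distr_plus[of c, symmetric], subst nn_integral_distr) auto
  interpret nu: sigma_finite_measure \<nu>
  proof
    show "\<exists>A. countable A \<and> A \<subseteq> sets \<nu> \<and> \<Union>A = space \<nu> \<and> (\<forall>a\<in>A. emeasure \<nu> a \<noteq> \<infinity>)"
    proof (intro exI[of _ "range (\<lambda>n. cball 0 (real n))"] conjI ballI)
      show "\<Union>(range (\<lambda>n. cball 0 (real n))) = space \<nu>"
        by (auto simp: \<nu>_def real_arch_simple)
      fix a assume "a \<in> range (\<lambda>n. cball (0::'a) (real n))"
      then obtain n where a: "a = cball 0 (real n)" by auto
      have "emeasure \<nu> a = emeasure lborel (cball (0::'a) (real n))"
        unfolding \<nu>_def a by (subst emeasure_distr) (auto simp: vimage_def norm cball_def)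
      also have "\<dots> \<noteq> \<infinity>" using emeasure_bounded_finite[of "cball (0::'a) (real n)"] by auto
      finally show "emeasure \<nu> a \<noteq> \<infinity>" .
    qed (auto simp: \<nu>_def)
  qed
  interpret pair_sigma_finite \<nu> lborel ..
  \<comment> \<open>A shift by \<open>y\<close> of the image point is the image of a shift by a
    preimage of \<open>y\<close>, and Lebesgue measure ignores the latter.\<close>
  have nu_shift: "(\<integral>\<^sup>+x. g (x + y) \<partial>\<nu>) = integral\<^sup>N \<nu> g"
    if [measurable]: "g \<in> borel_measurable borel" for g and y :: 'a
  proof -
    obtain z where z: "y = T z"
      using orthogonal_transformation_surj[OF T] by (metis surjD)
    have "(\<integral>\<^sup>+x. g (x + y) \<partial>\<nu>) = (\<integral>\<^sup>+x. g (T (z + x)) \<partial>lborel)"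
      by (subst nu_int) (auto simp: z linear_add[OF lin] add.commute)
    also have "\<dots> = (\<integral>\<^sup>+x. g (T x) \<partial>lborel)" by (rule shift) auto
    finally show ?thesis by (simp add: nu_int)
  qed
  show "sets (distr lborel borel T) = sets lborel" by simp
  fix A assume "A \<in> sets (distr lborel borel T)"
  hence [measurable]: "A \<in> sets borel" by simp
  define B where "B = cball (0::'a) 1"
  have [measurable]: "B \<in> sets borel" by (simp add: B_def)
  have B_minus: "- x \<in> B \<longleftrightarrow> x \<in> B" for x by (simp add: B_def)
  have nuB: "emeasure \<nu> B = emeasure lborel B"
    unfolding \<nu>_def B_def by (subst emeasure_distr) (auto simp: vimage_def norm cball_def)
  have "emeasure \<nu> A * emeasure lborel B = (\<integral>\<^sup>+x. indicator A x * emeasure lborel B \<partial>\<nu>)"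
    by (simp add: nn_integral_multc)
  also have "\<dots> = (\<integral>\<^sup>+x. indicator A x * (\<integral>\<^sup>+y. indicator B (- x + y) \<partial>lborel) \<partial>\<nu>)"
    by (subst shift) auto
  also have "\<dots> = (\<integral>\<^sup>+x. (\<integral>\<^sup>+y. indicator A x * indicator B (- x + y) \<partial>lborel) \<partial>\<nu>)"
    by (intro nn_integral_cong nn_integral_cmult[symmetric]) auto
  also have "\<dots> = (\<integral>\<^sup>+y. (\<integral>\<^sup>+x. indicator A x * indicator B (- x + y) \<partial>\<nu>) \<partial>lborel)"
    by (rule Fubini'[symmetric]) measurable
  \<comment> \<open>After this shift the indicator of \<open>B\<close> depends on \<open>x\<close>
    alone, and the integral over \<open>y\<close> will produce the Lebesgue measure of
    \<open>A\<close>.\<close>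
  also have "\<dots> = (\<integral>\<^sup>+y. (\<integral>\<^sup>+x. indicator A (x + y) * indicator B (- (x + y) + y) \<partial>\<nu>) \<partial>lborel)"
    by (intro nn_integral_cong nu_shift[symmetric]) measurable
  also have "\<dots> = (\<integral>\<^sup>+y. (\<integral>\<^sup>+x. indicator B x * indicator A (x + y) \<partial>\<nu>) \<partial>lborel)"
    by (intro nn_integral_cong) (auto simp: indicator_def B_minus)
  also have "\<dots> = (\<integral>\<^sup>+x. (\<integral>\<^sup>+y. indicator B x * indicator A (x + y) \<partial>lborel) \<partial>\<nu>)"
    by (rule Fubini') measurable
  also have "\<dots> = (\<integral>\<^sup>+x. indicator B x * (\<integral>\<^sup>+y. indicator A (x + y) \<partial>lborel) \<partial>\<nu>)"
    by (intro nn_integral_cong nn_integral_cmult) auto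
  also have "\<dots> = emeasure lborel B * emeasure lborel A"
    by (subst shift) (auto simp: nn_integral_multc nuB)
  finally have "emeasure \<nu> A * emeasure lborel B = emeasure lborel A * emeasure lborel B"
    by (simp add: mult.commute)
  moreover have "emeasure lborel B \<noteq> 0"
    using unit_ball_vol_pos[of "real DIM('a)"] by (simp add: B_def emeasure_cball less_imp_neq[symmetric])
  moreover have "emeasure lborel B \<noteq> \<top>"
    using emeasure_bounded_finite[of B] by (auto simp: B_def)
  ultimately show "emeasure (distr lborel borel T) A = emeasure lborel A"
    unfolding \<nu>_def[symmetric] by (metis mult_divide_eq_ennreal)
qed

section \<open>Laws of squared radii and the Beta integral\<close>

definition power_density :: "real \<Rightarrow> real \<Rightarrow> ennreal" where
  "power_density p x = ennreal (x powr (p - 1) * indicator {0..} x)"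

lemma power_density_measurable [measurable]: "power_density p \<in> borel_measurable borel"
  unfolding power_density_def by measurable

text \<open>Half-lines generate the Borel sets and are closed under intersection. The preimage of
  \<open>{..b}\<close> is a ball of radius \<open>sqrt b\<close>, whose volume is a constant times
  \<open>b powr (n / 2)\<close>; the density is the derivative of this volume in
  \<open>b\<close>.\<close>

lemma distr_PiM_sum_squares:
  fixes A :: "'i set"
  assumes A: "finite A" "A \<noteq> {}"
  defines "n \<equiv> real (card A)"
  shows "distr (Pi\<^sub>M A (\<lambda>_. lborel)) borel (\<lambda>z. \<Sum>i\<in>A. (z i)\<^sup>2) =
    density lborel (\<lambda>x. ennreal (n / 2 * unit_ball_vol n) * power_density (n / 2) x)"
    (is "?L = ?R")
proof (rule measure_eqI_generator_eq[where E="range atMost" and \<Omega>=UNIV and A="\<lambda>i. {..real i}"])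
  have n: "n > 0" using A by (simp add: n_def card_gt_0_iff)
  have L: "emeasure ?L {..b} = ennreal (unit_ball_vol n * b powr (n / 2))" if "b > 0" for b
  proof -
    have "emeasure ?L {..b} = emeasure (Pi\<^sub>M A (\<lambda>_. lborel))
       ({f. sqrt (\<Sum>i\<in>A. (f i)\<^sup>2) \<le> sqrt b} \<inter> space (Pi\<^sub>M A (\<lambda>_. lborel)))"
      using A by (subst emeasure_distr) (auto simp: vimage_def)
    also have "\<dots> = ennreal (unit_ball_vol n * sqrt b ^ card A)"
      unfolding n_def using that A by (intro emeasure_cball_aux) auto
    also have "sqrt b ^ card A = b powr (n / 2)"
      using that by (simp add: n_def powr_half_sqrt[symmetric] powr_powr flip: powr_realpow)
    finally show ?thesis .
  qed
  have R: "emeasure ?R {..b} = ennreal (unit_ball_vol n * b powr (n / 2))" if "b > 0" for b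
  proof -
    have "emeasure ?R {..b} = (\<integral>\<^sup>+x. ennreal (n / 2 * unit_ball_vol n * x powr (n / 2 - 1)) * indicator {0..b} x \<partial>lborel)"
      using n by (subst emeasure_density)
        (auto intro!: nn_integral_cong simp: indicator_def power_density_def ennreal_mult[symmetric])
    also have "\<dots> = ennreal (n / 2 * unit_ball_vol n * (b powr (n / 2) / (n / 2)))"
    proof (rule nn_integral_has_integral_lebesgue')
      show "((\<lambda>x. n / 2 * unit_ball_vol n * x powr (n / 2 - 1)) has_integral
        n / 2 * unit_ball_vol n * (b powr (n / 2) / (n / 2))) {0..b}"
        using has_integral_mult_right[OF has_integral_powr_from_0[of "n/2 - 1" b], of "n / 2 * unit_ball_vol n"]
          n that by simp
    qed (use n in auto)
    finally show ?thesis using n by simp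
  qed
  show "emeasure ?L X = emeasure ?R X" if "X \<in> range atMost" for X :: "real set"
  proof -
    from that obtain b where X: "X = {..b}" by auto
    show ?thesis
    proof (cases "b > 0")
      case False
      have "emeasure ?R {..b} = 0"
        using False by (subst emeasure_density) (auto simp: nn_integral_0_iff_AE indicator_def power_density_def intro!: AE_I[of _ _ "{0}"])
      moreover have "emeasure ?L {..b} = 0"
      proof -
        have "emeasure ?L {..b} \<le> ennreal e" if "e > 0" for e
        proof -
          \<comment> \<open>For \<open>b \<le> 0\<close> the half-line is contained in every
            \<open>{..c}\<close> with \<open>c > 0\<close>; this \<open>c\<close> makes the volume
            in \<open>L\<close> equal to \<open>e\<close>.\<close>
          define c where "c = (e / unit_ball_vol n) powr (2 / n)"
          have vol: "unit_ball_vol n > 0" using n by simp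
          have c: "c > 0" using that vol by (simp add: c_def)
          have "c powr (n / 2) = e / unit_ball_vol n"
            using n that vol by (simp add: c_def powr_powr)
          hence vol_c: "unit_ball_vol n * c powr (n / 2) = e" using vol by simp
          have "emeasure ?L {..b} \<le> emeasure ?L {..c}" using False c by (intro emeasure_mono) auto
          also have "\<dots> = ennreal (unit_ball_vol n * c powr (n / 2))" by (rule L[OF c])
          also have "\<dots> = ennreal e" by (simp only: vol_c)
          finally show ?thesis .
        qed
        hence "emeasure ?L {..b} \<le> 0 + ennreal e" if "e > 0" for e
          using that by simp
        hence "emeasure ?L {..b} \<le> 0" by (rule ennreal_le_epsilon)
        thus ?thesis by simp
      qed
      ultimately show ?thesis by (simp add: X)
    next
      case True
      show ?thesis unfolding X by (simp only: L[OF True] R[OF True])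
    qed
  qed
  show "emeasure ?L {..real i} \<noteq> \<infinity>" for i
  proof -
    \<comment> \<open>The successor avoids the bound 0, which \<open>L\<close> does not
      cover.\<close>
    have "emeasure ?L {..real i} \<le> emeasure ?L {..real (Suc i)}" by (intro emeasure_mono) auto
    also have "\<dots> < \<infinity>" by (subst L) auto
    finally show ?thesis by simp
  qed
  show "sets ?L = sigma_sets UNIV (range atMost)" "sets ?R = sigma_sets UNIV (range atMost)"
    by (simp_all add: borel_eq_atMost)
qed (auto simp: Int_stable_def real_arch_simple)

text \<open>
  The substitution is \<open>x = s u\<close>, \<open>y = s (1 - u)\<close>. The constant factor of the radial densities is
  irrelevant, because it cancels against the case \<open>a = 1\<close> in \<open>emeasure_ball_cone\<close>.
\<close>

lemma nn_integral_ratio: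
  fixes p q a :: real
  assumes "p > 0" "q > 0"
  shows "(\<integral>\<^sup>+x. \<integral>\<^sup>+y. power_density p x * power_density q y * indicator {(x, y). x + y \<le> 1 \<and> x \<le> a * (x + y)} (x, y) \<partial>lborel \<partial>lborel)
    = (\<integral>\<^sup>+s. ennreal (s powr (p + q - 1) * indicator {0..1} s) \<partial>lborel) *
      (\<integral>\<^sup>+u. ennreal (u powr (p - 1) * (1 - u) powr (q - 1) * indicator {0..1} u) * indicator {..a} u \<partial>lborel)"
    (is "?L = ?S * ?U")
proof -
  define g where "g x y = power_density p x * power_density q y * indicator {(x, y). x + y \<le> 1 \<and> x \<le> a * (x + y)} (x, y)" for x y
  have [measurable]: "(\<lambda>(x, y). g x y) \<in> borel_measurable (borel \<Otimes>\<^sub>M borel)"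
    unfolding g_def by measurable
  have "?L = (\<integral>\<^sup>+x. \<integral>\<^sup>+y. g x y \<partial>lborel \<partial>lborel)"
    by (simp add: g_def)
  also have "\<dots> = (\<integral>\<^sup>+x. \<integral>\<^sup>+s. g x (s - x) \<partial>lborel \<partial>lborel)"
  proof (rule nn_integral_cong)
    fix x :: real
    show "(\<integral>\<^sup>+y. g x y \<partial>lborel) = (\<integral>\<^sup>+s. g x (s - x) \<partial>lborel)"
      by (subst nn_integral_real_affine[of _ 1 "-x"]) (auto simp: algebra_simps)
  qed
  also have "\<dots> = (\<integral>\<^sup>+s. \<integral>\<^sup>+x. g x (s - x) \<partial>lborel \<partial>lborel)"
    by (rule lborel_pair.Fubini') measurable
  also have "\<dots> = (\<integral>\<^sup>+s. ennreal (s powr (p + q - 1) * indicator {0..1} s) * ?U \<partial>lborel)"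
  proof (rule nn_integral_cong_AE)
    have "AE s in lborel. s \<noteq> (0::real)" by (rule AE_lborel_singleton)
    thus "AE s in lborel. (\<integral>\<^sup>+x. g x (s - x) \<partial>lborel) = ennreal (s powr (p + q - 1) * indicator {0..1} s) * ?U"
    proof eventually_elim
      case (elim s)
      show ?case
      proof (cases "s > 0")
        case False
        hence "g x (s - x) = 0" for x using elim
          by (auto simp: g_def power_density_def indicator_def)
        thus ?thesis using False elim by (simp add: indicator_def)
      next
        case True
        have "(\<integral>\<^sup>+x. g x (s - x) \<partial>lborel) = ennreal s * (\<integral>\<^sup>+u. g (s * u) (s - s * u) \<partial>lborel)"
          using True by (subst nn_integral_real_affine[of _ s 0]) auto
        also have "\<dots> = (\<integral>\<^sup>+u. ennreal s * g (s * u) (s - s * u) \<partial>lborel)"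
          by (rule nn_integral_cmult[symmetric]) measurable
        also have "\<dots> = (\<integral>\<^sup>+u. ennreal (s powr (p + q - 1) * indicator {0..1} s) *
            (ennreal (u powr (p - 1) * (1 - u) powr (q - 1) * indicator {0..1} u) * indicator {..a} u) \<partial>lborel)"
        proof (rule nn_integral_cong)
          fix u :: real
          have le: "s * u \<le> a * s \<longleftrightarrow> u \<le> a" using True by (simp add: mult.commute)
          have "0 \<le> s - s * u \<longleftrightarrow> 0 \<le> s * (1 - u)" by (simp add: algebra_simps)
          also have "\<dots> \<longleftrightarrow> u \<le> 1" using True by (simp add: zero_le_mult_iff)
          finally have le1: "0 \<le> s - s * u \<longleftrightarrow> u \<le> 1" .
          have le0: "0 \<le> s * u \<longleftrightarrow> 0 \<le> u" using True by (simp add: zero_le_mult_iff)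
          have "s * ((s * u) powr (p - 1) * (s - s * u) powr (q - 1)) = s powr (p + q - 1) * (u powr (p - 1) * (1 - u) powr (q - 1))"
            if "0 \<le> u" "u \<le> 1"
          proof -
            have "(s - s * u) powr (q - 1) = s powr (q - 1) * (1 - u) powr (q - 1)"
              using that True by (subst powr_mult[symmetric]) (auto simp: algebra_simps)
            \<comment> \<open>The lone factor \<open>s\<close> is the Jacobian of
              \<open>x = s * u\<close>.\<close>
            moreover have "s powr (p + q - 1) = s * s powr (p - 1) * s powr (q - 1)"
              using True by (simp add: powr_add[symmetric] powr_mult_base add_diff_eq)
            ultimately show ?thesis using that True by (simp add: powr_mult)
          qed
          thus "ennreal s * g (s * u) (s - s * u) = ennreal (s powr (p + q - 1) * indicator {0..1} s) *
            (ennreal (u powr (p - 1) * (1 - u) powr (q - 1) * indicator {0..1} u) * indicator {..a} u)"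
            using True le le1 le0 unfolding g_def power_density_def
            by (auto simp: indicator_def ennreal_mult[symmetric])
        qed
        also have "\<dots> = ennreal (s powr (p + q - 1) * indicator {0..1} s) * ?U"
          by (rule nn_integral_cmult) measurable
        finally show ?thesis .
      qed
    qed
  qed
  also have "\<dots> = ?S * ?U" by (rule nn_integral_multc) measurable
  finally show ?thesis .
qed

lemma nn_integral_beta:
  assumes "p > 0" "q > 0"
  shows "(\<integral>\<^sup>+u. ennreal (u powr (p - 1) * (1 - u) powr (q - 1) * indicator {0..1} u) \<partial>lborel) = ennreal (Beta p q)"
proof -
  have "(\<integral>\<^sup>+u. ennreal (u powr (p - 1) * (1 - u) powr (q - 1)) * indicator {0..1} u \<partial>lborel) = ennreal (Beta p q)"
    by (rule nn_integral_has_integral_lebesgue'[OF _ has_integral_Beta_real]) (use assms in auto)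
  thus ?thesis by (simp add: ennreal_mult' ennreal_indicator)
qed

lemma nn_integral_beta_atMost:
  assumes "p > 0" "q > 0"
  shows "(\<integral>\<^sup>+u. ennreal (u powr (p - 1) * (1 - u) powr (q - 1) * indicator {0..1} u) * indicator {..a} u \<partial>lborel)
   = ennreal (Beta p q) * ennreal (reg_inc_beta a p q)"
proof -
  have B: "Beta p q > 0" using assms by (simp add: Beta_def)
  have eq: "emeasure (beta_distribution p q) X * ennreal (Beta p q) =
    (\<integral>\<^sup>+u. ennreal (u powr (p - 1) * (1 - u) powr (q - 1) * indicator {0..1} u) * indicator X u \<partial>lborel)"
    if [measurable]: "X \<in> sets borel" for X
  proof -
    have "emeasure (beta_distribution p q) X * ennreal (Beta p q) =
      (\<integral>\<^sup>+u. ennreal (indicator {0..1} u * (u powr (p - 1) * (1 - u) powr (q - 1) / Beta p q)) * indicator X u * ennreal (Beta p q) \<partial>lborel)"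
      using assms by (simp add: beta_distribution_def emeasure_density nn_integral_multc)
    also have "\<dots> = (\<integral>\<^sup>+u. ennreal (u powr (p - 1) * (1 - u) powr (q - 1) * indicator {0..1} u) * indicator X u \<partial>lborel)"
      using B by (intro nn_integral_cong) (auto simp: indicator_def ennreal_mult[symmetric])
    finally show ?thesis .
  qed
  have sp: "space (beta_distribution p q) = UNIV" using assms by (simp add: beta_distribution_def)
  \<comment> \<open>The function \<open>cdf\<close> is real-valued, so passing between it and
    \<open>emeasure\<close> calls for a finite measure; the total mass 1 provides that.\<close>
  have "emeasure (beta_distribution p q) UNIV * ennreal (Beta p q) = ennreal (Beta p q)"
    using nn_integral_beta[OF assms] by (subst eq) auto
  hence "emeasure (beta_distribution p q) UNIV = 1"
    using B mult_divide_eq_ennreal[of "ennreal (Beta p q)" "emeasure (beta_distribution p q) UNIV"]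
    by (simp add: less_top)
  hence "prob_space (beta_distribution p q)" by (intro prob_spaceI) (simp add: sp)
  then interpret prob_space "beta_distribution p q" .
  show ?thesis
    by (subst eq[symmetric]) (auto simp: reg_inc_beta_def cdf_def emeasure_eq_measure mult.commute)
qed

lemma borel_measurable_vec_lambda [measurable]:
  assumes "\<And>i. (\<lambda>z. g z i) \<in> borel_measurable M"
  shows "(\<lambda>z. (\<chi> i. g z i) :: real ^ 'n) \<in> borel_measurable M"
proof -
  have "(\<chi> i. g z i) = (\<Sum>i\<in>UNIV. g z i *\<^sub>R axis i 1 :: real ^ 'n)" for z
    by (simp add: vec_eq_iff axis_def if_distrib cong: if_cong)
  thus ?thesis using assms by simp
qed

text \<open>Lebesgue measure is determined by the volumes of boxes. The product form allows the
  coordinates in a set to be separated from the remaining ones.\<close>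

lemma lborel_vec_eq_distr_PiM:
  "(lborel :: (real ^ 'n) measure) = distr (Pi\<^sub>M UNIV (\<lambda>_. lborel)) borel (\<lambda>z. \<chi> i. z i)"
proof (rule lborel_eqI)
  interpret product_sigma_finite "\<lambda>_. lborel :: real measure" ..
  fix l u :: "real ^ 'n"
  assume le: "\<And>b. b \<in> Basis \<Longrightarrow> l \<bullet> b \<le> u \<bullet> b"
  have le': "l $ i \<le> u $ i" for i
    using le[of "axis i 1"] by (simp add: axis_in_Basis_iff inner_axis)
  have "emeasure (distr (Pi\<^sub>M UNIV (\<lambda>_. lborel)) borel (\<lambda>z. \<chi> i. z i)) (box l u) =
    emeasure (Pi\<^sub>M UNIV (\<lambda>_. lborel)) (Pi\<^sub>E UNIV (\<lambda>i. {l $ i <..< u $ i}))"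
    by (subst emeasure_distr) (auto simp: mem_box_cart space_PiM PiE_def Pi_def intro!: arg_cong2[where f=emeasure])
  also have "\<dots> = (\<Prod>i\<in>UNIV. ennreal (u $ i - l $ i))"
    using le' by (subst emeasure_PiM) auto
  also have "\<dots> = ennreal (\<Prod>i\<in>UNIV. (u $ i - l $ i))"
    using le' by (intro prod_ennreal) auto
  also have "(\<Prod>i\<in>UNIV. (u $ i - l $ i)) = (\<Prod>b\<in>Basis. (u - l) \<bullet> b)"
  proof -
    have B: "Basis = range (\<lambda>i. axis i 1 :: real ^ 'n)" by (auto simp: Basis_vec_def)
    have "inj (\<lambda>i. axis i 1 :: real ^ 'n)" by (auto simp: inj_on_def axis_eq_axis)
    thus ?thesis unfolding B by (simp add: prod.reindex inner_axis)
  qed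
  finally show "emeasure (distr (Pi\<^sub>M UNIV (\<lambda>_. lborel)) borel (\<lambda>z. \<chi> i. z i)) (box l u) =
    ennreal (\<Prod>b\<in>Basis. (u - l) \<bullet> b)" .
qed simp

text \<open>The squared norms over \<open>A\<close> and over \<open>- A\<close> carry the product
  measure to power densities, and \<open>nn_integral_ratio\<close> gives the volume up to a factor
  free of \<open>a\<close>. At \<open>a = 1\<close> the set is the whole ball, which identifies that
  factor.\<close>

lemma emeasure_ball_cone:
  fixes A :: "'n::finite set" and a :: real
  assumes A: "A \<noteq> {}" "- A \<noteq> {}"
  shows "emeasure lborel {v :: real ^ 'n. v \<bullet> v \<le> 1 \<and> (\<Sum>i\<in>A. (v $ i)\<^sup>2) \<le> a * (v \<bullet> v)} =
    emeasure lborel (cball (0 :: real ^ 'n) 1) * ennreal (reg_inc_beta a (real (card A) / 2) (real (card (- A)) / 2))"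
proof -
  interpret product_sigma_finite "\<lambda>_. lborel :: real measure" ..
  define p where "p = real (card A) / 2"
  define q where "q = real (card (- A)) / 2"
  have pq: "p > 0" "q > 0" using A by (simp_all add: p_def q_def card_gt_0_iff)
  define K1 where "K1 = ennreal (real (card A) / 2 * unit_ball_vol (real (card A)))"
  define K2 where "K2 = ennreal (real (card (- A)) / 2 * unit_ball_vol (real (card (- A))))"
  define S where "S = (\<integral>\<^sup>+s. ennreal (s powr (p + q - 1) * indicator {0..1} s) \<partial>lborel)"
  define U where "U a = (\<integral>\<^sup>+u. ennreal (u powr (p - 1) * (1 - u) powr (q - 1) * indicator {0..1} u) * indicator {..a} u \<partial>lborel)" for a
  define E where "E a = {v :: real ^ 'n. v \<bullet> v \<le> 1 \<and> (\<Sum>i\<in>A. (v $ i)\<^sup>2) \<le> a * (v \<bullet> v)}" for a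
  have vv: "v \<bullet> v = (\<Sum>i\<in>A. (v $ i)\<^sup>2) + (\<Sum>i\<in>-A. (v $ i)\<^sup>2)" for v :: "real ^ 'n"
    using sum.Int_Diff[of UNIV "\<lambda>i. (v $ i)\<^sup>2" A]
    by (simp add: inner_vec_def power2_eq_square Compl_eq_Diff_UNIV)
  have dist1: "distr (Pi\<^sub>M A (\<lambda>_. lborel)) borel (\<lambda>x. \<Sum>i\<in>A. (x i)\<^sup>2) =
      density lborel (\<lambda>x. K1 * power_density p x)"
    unfolding K1_def p_def using A by (intro distr_PiM_sum_squares) auto
  have dist2: "distr (Pi\<^sub>M (- A) (\<lambda>_. lborel)) borel (\<lambda>x. \<Sum>i\<in>-A. (x i)\<^sup>2) =
      density lborel (\<lambda>x. K2 * power_density q x)"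
    unfolding K2_def q_def using A by (intro distr_PiM_sum_squares) auto
  have main: "emeasure lborel (E a) = K1 * K2 * S * U a" for a
  proof -
    define h where "h x y = (indicator {(x, y). x + y \<le> 1 \<and> x \<le> a * (x + y)} (x, y) :: ennreal)" for x y :: real
    have [measurable]: "(\<lambda>(x, y). h x y) \<in> borel_measurable (borel \<Otimes>\<^sub>M borel)"
      unfolding h_def by measurable
    have [measurable]: "E a \<in> sets borel" unfolding E_def by measurable
    have "emeasure lborel (E a) = (\<integral>\<^sup>+v. indicator (E a) v \<partial>lborel)" by simp
    also have "\<dots> = (\<integral>\<^sup>+z. indicator (E a) (\<chi> i. z i) \<partial>Pi\<^sub>M UNIV (\<lambda>_. lborel))"
      by (subst lborel_vec_eq_distr_PiM, subst nn_integral_distr) auto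
    also have "\<dots> = (\<integral>\<^sup>+z. h (\<Sum>i\<in>A. (z i)\<^sup>2) (\<Sum>i\<in>-A. (z i)\<^sup>2) \<partial>Pi\<^sub>M (A \<union> - A) (\<lambda>_. lborel))"
      by (intro nn_integral_cong_simp arg_cong2[where f=nn_integral])
        (auto simp: h_def E_def vv indicator_def fun_eq_iff)
    also have "\<dots> = (\<integral>\<^sup>+x. \<integral>\<^sup>+y. h (\<Sum>i\<in>A. (merge A (- A) (x, y) i)\<^sup>2) (\<Sum>i\<in>-A. (merge A (- A) (x, y) i)\<^sup>2)
        \<partial>Pi\<^sub>M (- A) (\<lambda>_. lborel) \<partial>Pi\<^sub>M A (\<lambda>_. lborel))"
      by (rule product_nn_integral_fold) auto
    also have "\<dots> = (\<integral>\<^sup>+x. \<integral>\<^sup>+y. h (\<Sum>i\<in>A. (x i)\<^sup>2) (\<Sum>i\<in>-A. (y i)\<^sup>2)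
        \<partial>Pi\<^sub>M (- A) (\<lambda>_. lborel) \<partial>Pi\<^sub>M A (\<lambda>_. lborel))"
      by (simp add: merge_def)
    also have "\<dots> = (\<integral>\<^sup>+x. \<integral>\<^sup>+y. h (\<Sum>i\<in>A. (x i)\<^sup>2) y
        \<partial>distr (Pi\<^sub>M (- A) (\<lambda>_. lborel)) borel (\<lambda>y. \<Sum>i\<in>-A. (y i)\<^sup>2) \<partial>Pi\<^sub>M A (\<lambda>_. lborel))"
      by (subst nn_integral_distr) auto
    also have "\<dots> = (\<integral>\<^sup>+x. K2 * (\<integral>\<^sup>+y. power_density q y * h (\<Sum>i\<in>A. (x i)\<^sup>2) y \<partial>lborel) \<partial>Pi\<^sub>M A (\<lambda>_. lborel))"
      unfolding dist2 by (subst nn_integral_density) (auto simp: mult.assoc nn_integral_cmult)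
    also have "\<dots> = (\<integral>\<^sup>+x. K2 * (\<integral>\<^sup>+y. power_density q y * h x y \<partial>lborel)
        \<partial>distr (Pi\<^sub>M A (\<lambda>_. lborel)) borel (\<lambda>x. \<Sum>i\<in>A. (x i)\<^sup>2))"
      by (subst nn_integral_distr) auto
    also have "\<dots> = K1 * (\<integral>\<^sup>+x. power_density p x * (K2 * (\<integral>\<^sup>+y. power_density q y * h x y \<partial>lborel)) \<partial>lborel)"
      unfolding dist1 by (subst nn_integral_density) (auto simp: mult.assoc nn_integral_cmult)
    also have "\<dots> = K1 * (K2 * (\<integral>\<^sup>+x. power_density p x * (\<integral>\<^sup>+y. power_density q y * h x y \<partial>lborel) \<partial>lborel))"
      by (simp add: nn_integral_cmult mult.left_commute)
    also have "(\<integral>\<^sup>+x. power_density p x * (\<integral>\<^sup>+y. power_density q y * h x y \<partial>lborel) \<partial>lborel) =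
      (\<integral>\<^sup>+x. \<integral>\<^sup>+y. power_density p x * power_density q y * h x y \<partial>lborel \<partial>lborel)"
      by (simp add: nn_integral_cmult mult.assoc)
    also have "\<dots> = S * U a"
      unfolding h_def S_def U_def by (rule nn_integral_ratio[OF pq])
    finally show ?thesis by (simp add: mult.assoc)
  qed
  have "U 1 = (\<integral>\<^sup>+u. ennreal (u powr (p - 1) * (1 - u) powr (q - 1) * indicator {0..1} u) \<partial>lborel)"
    unfolding U_def by (intro nn_integral_cong) (auto simp: indicator_def)
  hence U1: "U 1 = ennreal (Beta p q)" using nn_integral_beta[OF pq] by simp
  have "E 1 = cball 0 1"
    by (auto simp: E_def vv sum_nonneg norm_eq_sqrt_inner)
  moreover have "U a = ennreal (Beta p q) * ennreal (reg_inc_beta a p q)"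
    unfolding U_def by (rule nn_integral_beta_atMost[OF pq])
  ultimately show ?thesis using main[of 1] main[of a]
    unfolding E_def[symmetric] p_def[symmetric] q_def[symmetric] by (simp add: U1 mult.assoc)
qed

section \<open>Columns of a Haar-distributed orthogonal matrix\<close>

lemma norm_matrix_vector_orthogonal:
  fixes Q :: "real ^ 'n ^ 'n"
  assumes "orthogonal_matrix Q"
  shows "norm (transpose Q *v v) = norm v"
  using assms
  by (metis orthogonal_matrix_transpose orthogonal_transformation orthogonal_transformation_matrix
      matrix_of_matrix_vector_mul matrix_vector_mul_linear)

text \<open>Some orthogonal \<open>T\<close> takes \<open>v\<close> to \<open>w\<close>. With
  \<open>U\<close> the transpose of its matrix, replacing \<open>Q\<close> by \<open>U ** Q\<close>
  turns \<open>transpose Q *v v\<close> into \<open>transpose Q *v w\<close>, and left invariance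
  says that this replacement keeps the measure.\<close>

lemma haar_orthogonal_rotate:
  fixes \<mu> :: "(real ^ 'n ^ 'n) measure"
  assumes haar: "haar_orthogonal \<mu>" and eq: "norm v = norm w"
    and [measurable]: "{x. \<Phi> x} \<in> sets (borel :: (real ^ 'n) measure)"
  shows "emeasure \<mu> {Q. \<Phi> (transpose Q *v v)} = emeasure \<mu> {Q. \<Phi> (transpose Q *v w)}"
proof -
  have sets_mu [measurable_cong]: "sets \<mu> = sets borel" using haar by (simp add: haar_orthogonal_def)
  obtain T where T: "orthogonal_transformation T" "T v = w"
    using orthogonal_transformation_exists[OF eq] by blast
  define U where "U = transpose (matrix T)"
  have U: "orthogonal_matrix U"
    using T by (simp add: U_def orthogonal_matrix_transpose orthogonal_transformation_matrix)
  have Uv: "transpose U *v v = w"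
    using T by (simp add: U_def orthogonal_transformation_linear matrix_works)
  have cont: "continuous_on UNIV (\<lambda>Q :: real^'n^'n. U ** Q)"
    unfolding matrix_matrix_mult_def by (intro continuous_intros)
  have cont2: "continuous_on UNIV (\<lambda>Q :: real^'n^'n. transpose Q *v v)" for v
    unfolding matrix_vector_mult_def transpose_def by (auto intro!: continuous_intros)
  have [measurable]: "(\<lambda>Q :: real^'n^'n. U ** Q) \<in> borel_measurable borel"
     "(\<lambda>Q :: real^'n^'n. transpose Q *v v) \<in> borel_measurable borel"
    using cont cont2 by (auto intro: borel_measurable_continuous_onI)
  have m: "{Q. \<Phi> (transpose Q *v v)} \<in> sets borel" 
    using measurable_sets[OF \<open>(\<lambda>Q :: real^'n^'n. transpose Q *v v) \<in> borel_measurable borel\<close> assms(3)]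
    by (simp add: vimage_def)
  have "emeasure \<mu> {Q. \<Phi> (transpose Q *v v)} = emeasure (distr \<mu> borel (\<lambda>Q. U ** Q)) {Q. \<Phi> (transpose Q *v v)}"
    using haar U by (simp add: haar_orthogonal_def)
  also have "\<dots> = emeasure \<mu> {Q. \<Phi> (transpose Q *v (transpose U *v v))}"
    using m sets_eq_imp_space_eq[OF sets_mu]
    by (subst emeasure_distr) (auto simp: vimage_def matrix_transpose_mul matrix_vector_mul_assoc
        simp del: transpose_matrix_vector)
  finally show ?thesis by (simp only: Uv)
qed

text \<open>For a single \<open>v\<close> the vector \<open>transpose Q *v v\<close> is uniform on a
  sphere. Integrating over all \<open>v\<close> in the ball replaces the surface measure by Lebesgue
  measure, for which \<open>emeasure_ball_cone\<close> is available.\<close>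

lemma haar_orthogonal_projection:
  fixes \<mu> :: "(real ^ 'n ^ 'n) measure" and A :: "'n set" and a :: real
  assumes haar: "haar_orthogonal \<mu>" and A: "A \<noteq> {}" "- A \<noteq> {}" and v: "v \<noteq> 0"
  shows "emeasure \<mu> {Q. (\<Sum>i\<in>A. ((transpose Q *v v) $ i)\<^sup>2) \<le> a * (v \<bullet> v)} =
    ennreal (reg_inc_beta a (real (card A) / 2) (real (card (- A)) / 2))"
proof -
  have sets_mu [measurable_cong]: "sets \<mu> = sets borel" and orth: "AE Q in \<mu>. orthogonal_matrix Q"
    and "prob_space \<mu>"
    using haar by (simp_all add: haar_orthogonal_def)
  interpret prob_space \<mu> by fact
  interpret pair_sigma_finite \<mu> "lborel :: (real ^ 'n) measure" ..
  have space_mu: "space \<mu> = UNIV" using sets_eq_imp_space_eq[OF sets_mu] by simp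
  define C where "C = {x :: real ^ 'n. (\<Sum>i\<in>A. (x $ i)\<^sup>2) \<le> a * (x \<bullet> x)}"
  define B where "B = cball (0 :: real ^ 'n) 1"
  define G where "G w = emeasure \<mu> {Q. (\<Sum>i\<in>A. ((transpose Q *v w) $ i)\<^sup>2) \<le> a * (w \<bullet> w)}" for w
  have [measurable]: "C \<in> sets borel" "B \<in> sets borel" unfolding C_def B_def by measurable
  have cont: "continuous_on UNIV (\<lambda>(Q :: real^'n^'n, w :: real ^ 'n). transpose Q *v w)"
    unfolding matrix_vector_mult_def transpose_def split_beta by (auto intro!: continuous_intros)
  have [measurable]: "(\<lambda>(Q :: real^'n^'n, w :: real ^ 'n). transpose Q *v w) \<in> borel_measurable (borel \<Otimes>\<^sub>M borel)"
    using borel_measurable_continuous_onI[OF cont] by (simp add: borel_prod)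
  \<comment> \<open>Replacing \<open>w \<bullet> w\<close> by the squared norm of
    \<open>transpose Q *v w\<close>, equal to it for orthogonal \<open>Q\<close>, expresses the
    event through that vector alone, as \<open>haar_orthogonal_rotate\<close> demands.\<close>
  have G: "G w = emeasure \<mu> {Q. transpose Q *v w \<in> C}" for w
    unfolding G_def
  proof (rule emeasure_eq_AE)
    show "AE Q in \<mu>. (Q \<in> {Q. (\<Sum>i\<in>A. ((transpose Q *v w) $ i)\<^sup>2) \<le> a * (w \<bullet> w)}) = (Q \<in> {Q. transpose Q *v w \<in> C})"
      using orth
    proof eventually_elim
      case (elim Q)
      have "(transpose Q *v w) \<bullet> (transpose Q *v w) = w \<bullet> w"
        using norm_matrix_vector_orthogonal[OF elim, of w] by (simp add: norm_eq_sqrt_inner)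
      thus ?case by (simp add: C_def)
    qed
    have "{Q \<in> space \<mu>. (\<Sum>i\<in>A. ((transpose Q *v w) $ i)\<^sup>2) \<le> a * (w \<bullet> w)} \<in> sets \<mu>" by measurable
    thus "{Q. (\<Sum>i\<in>A. ((transpose Q *v w) $ i)\<^sup>2) \<le> a * (w \<bullet> w)} \<in> sets \<mu>" by (simp add: space_mu)
    have "{Q \<in> space \<mu>. transpose Q *v w \<in> C} \<in> sets \<mu>" by measurable
    thus "{Q. transpose Q *v w \<in> C} \<in> sets \<mu>" by (simp add: space_mu)
  qed
  have G_const: "G w = G v" if w: "w \<noteq> 0" for w
  proof -
    define c where "c = norm v / norm w"
    have c: "c > 0" "norm (c *\<^sub>R w) = norm v" using v w by (simp_all add: c_def)
    \<comment> \<open>The set \<open>C\<close> is a cone, so \<open>w\<close> may be rescaled to the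
      norm of \<open>v\<close> before rotating.\<close>
    have "x \<in> C \<longleftrightarrow> c *\<^sub>R x \<in> C" for x
    proof -
      have "c *\<^sub>R x \<in> C \<longleftrightarrow> c\<^sup>2 * (\<Sum>i\<in>A. (x $ i)\<^sup>2) \<le> c\<^sup>2 * (a * (x \<bullet> x))"
        by (simp add: C_def power_mult_distrib sum_distrib_left power2_eq_square mult_ac)
      thus ?thesis using c by (simp add: C_def)
    qed
    hence "G w = emeasure \<mu> {Q. transpose Q *v (c *\<^sub>R w) \<in> C}"
      by (simp add: G matrix_vector_mult_scaleR)
    also have "\<dots> = G v" unfolding G using c by (intro haar_orthogonal_rotate[OF haar]) auto
    finally show ?thesis .
  qed
  have "emeasure lborel B * G v = (\<integral>\<^sup>+w. indicator B w * G v \<partial>lborel)"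
    by (simp add: nn_integral_multc)
  also have "\<dots> = (\<integral>\<^sup>+w. indicator B w * G w \<partial>lborel)"
    by (rule nn_integral_cong_AE) (use AE_lborel_singleton[of "0 :: real ^ 'n"] G_const in auto)
  also have "\<dots> = (\<integral>\<^sup>+w. \<integral>\<^sup>+Q. indicator B w * indicator C (transpose Q *v w) \<partial>\<mu> \<partial>lborel)"
  proof (rule nn_integral_cong)
    fix w :: "real ^ 'n"
    have "{Q \<in> space \<mu>. transpose Q *v w \<in> C} \<in> sets \<mu>" by measurable
    hence "G w = (\<integral>\<^sup>+Q. indicator {Q. transpose Q *v w \<in> C} Q \<partial>\<mu>)"
      unfolding G by (subst nn_integral_indicator) (simp_all add: space_mu)
    also have "\<dots> = (\<integral>\<^sup>+Q. indicator C (transpose Q *v w) \<partial>\<mu>)"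
      by (intro nn_integral_cong) (simp add: indicator_def)
    finally have Gw: "G w = (\<integral>\<^sup>+Q. indicator C (transpose Q *v w) \<partial>\<mu>)" .
    show "indicator B w * G w = (\<integral>\<^sup>+Q. indicator B w * indicator C (transpose Q *v w) \<partial>\<mu>)"
      unfolding Gw by (rule nn_integral_cmult[symmetric]) measurable
  qed
  also have "\<dots> = (\<integral>\<^sup>+Q. \<integral>\<^sup>+w. indicator B w * indicator C (transpose Q *v w) \<partial>lborel \<partial>\<mu>)"
    by (rule Fubini') measurable
  \<comment> \<open>For orthogonal \<open>Q\<close> the map given by \<open>transpose Q\<close>
    preserves both \<open>B\<close> and Lebesgue measure, so the inner integral no longer depends on
    \<open>Q\<close>.\<close>
  also have "\<dots> = (\<integral>\<^sup>+Q. emeasure lborel (B \<inter> C) \<partial>\<mu>)"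
  proof (rule nn_integral_cong_AE, use orth in eventually_elim)
    case (elim Q)
    have T: "orthogonal_transformation (\<lambda>w. transpose Q *v w)"
      unfolding orthogonal_transformation
      using norm_matrix_vector_orthogonal[OF elim] matrix_vector_mul_linear[of "transpose Q"] by blast
    have [measurable]: "(\<lambda>w. transpose Q *v w) \<in> borel_measurable borel"
      by (intro borel_measurable_continuous_onI linear_continuous_on matrix_vector_mul_bounded_linear)
    have "(\<integral>\<^sup>+w. indicator B w * indicator C (transpose Q *v w) \<partial>lborel) =
      (\<integral>\<^sup>+w. indicator (B \<inter> C) (transpose Q *v w) \<partial>lborel)"
      by (intro nn_integral_cong) (auto simp: indicator_def B_def
          norm_matrix_vector_orthogonal[OF elim, simplified])
    also have "\<dots> = (\<integral>\<^sup>+w. indicator (B \<inter> C) w \<partial>distr lborel borel (\<lambda>w. transpose Q *v w))"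
      by (subst nn_integral_distr) auto
    also have "\<dots> = emeasure lborel (B \<inter> C)"
      unfolding lborel_distr_orthogonal[OF T] by simp
    finally show ?case .
  qed
  also have "\<dots> = emeasure lborel (B \<inter> C)"
    by (simp add: emeasure_space_1)
  also have "B \<inter> C = {v :: real ^ 'n. v \<bullet> v \<le> 1 \<and> (\<Sum>i\<in>A. (v $ i)\<^sup>2) \<le> a * (v \<bullet> v)}"
    by (auto simp: B_def C_def norm_eq_sqrt_inner)
  also have "emeasure lborel \<dots> = emeasure lborel B * ennreal (reg_inc_beta a (real (card A) / 2) (real (card (- A)) / 2))"
    unfolding B_def by (rule emeasure_ball_cone[OF A])
  finally have "G v * emeasure lborel B = ennreal (reg_inc_beta a (real (card A) / 2) (real (card (- A)) / 2)) * emeasure lborel B"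
    by (simp only: mult.commute)
  moreover have "emeasure lborel B \<noteq> 0"
    using unit_ball_vol_pos[of "real DIM(real ^ 'n)"] by (simp add: B_def emeasure_cball less_imp_neq[symmetric])
  moreover have "emeasure lborel B \<noteq> \<top>"
    using emeasure_bounded_finite[of B] by (auto simp: B_def)
  ultimately show ?thesis
    unfolding G_def[symmetric] by (metis mult_divide_eq_ennreal)
qed

section \<open>Selection and scaling of columns\<close>

lemma bij_betw_card_lessThan:
  "bij_betw (\<lambda>i :: 'a::{finite,linorder}. card {..<i}) UNIV {..<CARD('a)}"
proof -
  have less: "card {..<i} < card {..<j}" if "i < j" for i j :: 'a
    using that by (intro psubset_card_mono) auto
  have inj: "inj (\<lambda>i :: 'a. card {..<i})"
    by (intro injI) (metis less less_irrefl linorder_neqE)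
  have "card {..<i} < CARD('a)" for i :: 'a
    by (intro psubset_card_mono) auto
  hence "range (\<lambda>i :: 'a. card {..<i}) \<subseteq> {..<CARD('a)}" by auto
  thus ?thesis
    using inj by (simp add: bij_betw_def card_image card_subset_eq)
qed

text \<open>Positions in a finite linear order fill an initial segment of the naturals, so composing
  the position map of \<open>'l\<close> with the inverse of that of \<open>'d\<close> embeds one
  index type in the other. Right multiplication by \<open>id_columns\<close> then selects the
  columns indexed by \<open>\<pi>\<close>.\<close>

lemma id_columns_eq:
  assumes "CARD('l) \<le> CARD('d)"
  obtains \<pi> :: "'l::{finite,linorder} \<Rightarrow> 'd::{finite,linorder}"
  where "inj \<pi>" "(id_columns :: ('d, 'l) rmat) = (\<chi> i j. if i = \<pi> j then 1 else 0)"
proof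
  define c where "c i = card {..<i}" for i :: 'd
  define c' where "c' j = card {..<j}" for j :: 'l
  have c: "bij_betw c UNIV {..<CARD('d)}" "bij_betw c' UNIV {..<CARD('l)}"
    unfolding c_def c'_def by (rule bij_betw_card_lessThan)+
  define \<pi> where "\<pi> = inv c \<circ> c'"
  have in_range: "c' j \<in> range c" for j
    using c assms unfolding bij_betw_def by (metis UNIV_I image_eqI lessThan_iff order_less_le_trans)
  have c_\<pi>: "c (\<pi> j) = c' j" for j
    using in_range by (simp add: \<pi>_def f_inv_into_f)
  have inj: "inj c" "inj c'" using c by (auto simp: bij_betw_def)
  show "inj \<pi>" by (rule injI) (metis c_\<pi> inj(2) injD)
  have "c i = c' j \<longleftrightarrow> i = \<pi> j" for i j
    by (metis c_\<pi> inj(1) injD)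
  thus "(id_columns :: ('d, 'l) rmat) = (\<chi> i j. if i = \<pi> j then 1 else 0)"
    by (simp add: id_columns_def c_def c'_def)
qed

lemma continuous_on_scaled_matrix_mult:
  fixes E :: "real ^ 'l ^ 'd"
  shows "continuous_on UNIV (\<lambda>Q :: real ^ 'd ^ 'd. c *\<^sub>R (Q ** E))"
  unfolding matrix_matrix_mult_def by (intro continuous_intros)

text \<open>The two facts about the law of the sketch that the iteration uses. The squared norm of
  \<open>transpose P *v v\<close> is \<open>d / l\<close> times the part of the squared norm of
  \<open>transpose Q *v v\<close> in the coordinates \<open>range \<pi>\<close>; this scaling puts
  the threshold at \<open>(1 - \<epsilon>) * l / d\<close>.\<close>

lemma haar_scaled_columns:
  fixes \<mu> :: "('d::{finite,linorder}, 'd) rmat measure"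
    and d l :: nat
  assumes haar: "haar_orthogonal \<mu>"
    and dim: "d = CARD('d)" "l = CARD('l::{finite,linorder})" "l \<le> d"
  defines "\<nu> \<equiv> distr \<mu> borel (\<lambda>Q. sqrt (real d / real l) *\<^sub>R (Q ** (id_columns :: ('d, 'l) rmat)))"
  shows "AE P in \<nu>. transpose P ** P = (real d / real l) *\<^sub>R mat 1"
    and "\<epsilon> \<ge> 0 \<Longrightarrow>
      1 - reg_inc_beta ((1 - \<epsilon>) * real l / real d) (real l / 2) ((real d - real l) / 2) \<ge> \<delta> \<Longrightarrow> \<delta> \<le> 1 \<Longrightarrow>
      measure \<nu> {P. (1 - \<epsilon>) * (v \<bullet> v) \<le> (transpose P *v v) \<bullet> (transpose P *v v)} \<ge> \<delta>"
proof -
  have sets_mu [measurable_cong]: "sets \<mu> = sets borel" and orth: "AE Q in \<mu>. orthogonal_matrix Q"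
    and "prob_space \<mu>"
    using haar by (simp_all add: haar_orthogonal_def)
  interpret prob_space \<mu> by fact
  have space_mu: "space \<mu> = UNIV" using sets_eq_imp_space_eq[OF sets_mu] by simp
  obtain \<pi> :: "'l \<Rightarrow> 'd" where \<pi>: "inj \<pi>"
    and id_cols: "(id_columns :: ('d, 'l) rmat) = (\<chi> i j. if i = \<pi> j then 1 else 0)"
    using id_columns_eq dim by metis
  define F where "F Q = sqrt (real d / real l) *\<^sub>R (Q ** (id_columns :: ('d, 'l) rmat))"
    for Q :: "('d, 'd) rmat"
  have ldpos: "l > 0" "d > 0" using dim by auto
  have [measurable]: "F \<in> borel_measurable borel"
    unfolding F_def by (intro borel_measurable_continuous_onI continuous_on_scaled_matrix_mult)
  have F_nth: "F Q $ i $ j = sqrt (real d / real l) * Q $ i $ \<pi> j" for Q i j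
    by (simp add: F_def id_cols matrix_matrix_mult_def if_distrib cong: if_cong)
  have scaled_mult: "S * a * (S * b) = X * (a * b)" if "S * S = X" for S X a b :: real
    by (simp add: that[symmetric] mult_ac)
  have FF: "transpose (F Q) ** F Q = (real d / real l) *\<^sub>R mat 1" if "orthogonal_matrix Q" for Q
  proof -
    have "(transpose Q ** Q) $ \<pi> i $ \<pi> j = (mat 1 :: ('d, 'd) rmat) $ \<pi> i $ \<pi> j" for i j
      using that by (simp add: orthogonal_matrix_def)
    hence "(\<Sum>k\<in>UNIV. Q $ k $ \<pi> i * Q $ k $ \<pi> j) = (if i = j then 1 else 0)" for i j
      using \<pi> by (simp add: matrix_matrix_mult_def transpose_def mat_def inj_eq)
    moreover have "(transpose (F Q) ** F Q) $ i $ j = real d / real l * (\<Sum>k\<in>UNIV. Q $ k $ \<pi> i * Q $ k $ \<pi> j)" for i j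
    proof -
      have "F Q $ k $ i * F Q $ k $ j = real d / real l * (Q $ k $ \<pi> i * Q $ k $ \<pi> j)" for k
        unfolding F_nth by (rule scaled_mult) simp
      thus ?thesis by (simp add: matrix_matrix_mult_def transpose_def sum_distrib_left)
    qed
    ultimately show ?thesis by (simp add: vec_eq_iff mat_def)
  qed
  have cont: "continuous_on UNIV (\<lambda>P :: ('d, 'l) rmat. transpose P ** P)"
    unfolding matrix_matrix_mult_def transpose_def by (auto intro!: continuous_intros)
  have "{P :: ('d, 'l) rmat. transpose P ** P = (real d / real l) *\<^sub>R mat 1} \<in> sets borel"
    by (intro borel_closed closed_Collect_eq cont continuous_intros)
  thus "AE P in \<nu>. transpose P ** P = (real d / real l) *\<^sub>R mat 1"
    unfolding \<nu>_def F_def[symmetric] by (subst AE_distr_iff) (use orth FF in \<open>auto elim!: eventually_mono\<close>)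

  assume \<epsilon>: "\<epsilon> \<ge> 0" and \<delta>: "\<delta> \<le> 1"
    and large: "1 - reg_inc_beta ((1 - \<epsilon>) * real l / real d) (real l / 2) ((real d - real l) / 2) \<ge> \<delta>"
  define A where "A = range \<pi>"
  have card_A: "card A = l" using \<pi> dim by (simp add: A_def card_image)
  have proj: "(transpose (F Q) *v v) \<bullet> (transpose (F Q) *v v) =
      real d / real l * (\<Sum>i\<in>A. ((transpose Q *v v) $ i)\<^sup>2)" for Q
  proof -
    have "(transpose (F Q) *v v) $ j = sqrt (real d / real l) * (transpose Q *v v) $ \<pi> j" for j
      by (simp add: matrix_vector_mult_def transpose_def F_nth sum_distrib_left mult_ac del: transpose_matrix_vector)
    hence "(transpose (F Q) *v v) $ j * (transpose (F Q) *v v) $ j =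
        real d / real l * ((transpose Q *v v) $ \<pi> j)\<^sup>2" for j
      unfolding power2_eq_square by (simp only:) (rule scaled_mult, simp)
    hence "(transpose (F Q) *v v) \<bullet> (transpose (F Q) *v v) =
        (\<Sum>j\<in>UNIV. real d / real l * ((transpose Q *v v) $ \<pi> j)\<^sup>2)"
      by (simp only: inner_vec_def inner_real_def)
    also have "\<dots> = real d / real l * (\<Sum>i\<in>A. ((transpose Q *v v) $ i)\<^sup>2)"
      using \<pi> by (simp only: A_def sum.reindex sum_distrib_left[symmetric] o_def)
    finally show ?thesis .
  qed
  have cont2: "continuous_on UNIV (\<lambda>P :: ('d, 'l) rmat. (transpose P *v v) \<bullet> (transpose P *v v))"
    unfolding matrix_vector_mult_def transpose_def by (auto intro!: continuous_intros)
  have cont3: "continuous_on UNIV (\<lambda>Q :: ('d, 'd) rmat. (\<Sum>i\<in>A. ((transpose Q *v v) $ i)\<^sup>2))"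
    unfolding matrix_vector_mult_def transpose_def by (auto intro!: continuous_intros)
  have "{P :: ('d, 'l) rmat. (1 - \<epsilon>) * (v \<bullet> v) \<le> (transpose P *v v) \<bullet> (transpose P *v v)} \<in> sets borel"
    by (intro borel_closed closed_Collect_le cont2 continuous_intros)
  hence "measure \<nu> {P. (1 - \<epsilon>) * (v \<bullet> v) \<le> (transpose P *v v) \<bullet> (transpose P *v v)} =
    prob {Q. (1 - \<epsilon>) * (v \<bullet> v) \<le> real d / real l * (\<Sum>i\<in>A. ((transpose Q *v v) $ i)\<^sup>2)}"
    unfolding \<nu>_def F_def[symmetric]
    by (subst measure_distr) (auto simp: vimage_def proj space_mu simp del: transpose_matrix_vector)
  also have "\<dots> \<ge> \<delta>"
  proof (cases "v = 0")
    case True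
    thus ?thesis using prob_space \<delta> by (simp add: space_mu)
  next
    case False
    show ?thesis
    proof (cases "l = d")
      \<comment> \<open>With no coordinates left over, \<open>haar_orthogonal_projection\<close>
        does not apply; but here \<open>Q\<close> preserves the full norm, and the event holds
        almost surely.\<close>
      case True
      hence A: "A = UNIV" using card_A dim by (metis card_subset_eq finite subset_UNIV)
      have "AE Q in \<mu>. (1 - \<epsilon>) * (v \<bullet> v) \<le> real d / real l * (\<Sum>i\<in>A. ((transpose Q *v v) $ i)\<^sup>2)"
        using orth
      proof eventually_elim
        case (elim Q)
        have "(\<Sum>i\<in>A. ((transpose Q *v v) $ i)\<^sup>2) = (transpose Q *v v) \<bullet> (transpose Q *v v)"
          by (simp add: A inner_vec_def power2_eq_square)
        also have "\<dots> = v \<bullet> v"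
          using norm_matrix_vector_orthogonal[OF elim, of v] by (simp add: norm_eq_sqrt_inner)
        finally show ?case using \<epsilon> True ldpos by (simp add: algebra_simps)
      qed
      moreover have "{Q. (1 - \<epsilon>) * (v \<bullet> v) \<le> real d / real l * (\<Sum>i\<in>A. ((transpose Q *v v) $ i)\<^sup>2)} \<in> sets borel"
        by (intro borel_closed closed_Collect_le cont3 continuous_intros)
      ultimately have "prob {Q. (1 - \<epsilon>) * (v \<bullet> v) \<le> real d / real l * (\<Sum>i\<in>A. ((transpose Q *v v) $ i)\<^sup>2)} = 1"
        unfolding sets_mu[symmetric] by (simp only: prob_eq_1 mem_Collect_eq)
      thus ?thesis using \<delta> by (simp only:)
    next
      case l: False
      define a where "a = (1 - \<epsilon>) * real l / real d"
      have "A \<noteq> UNIV" using card_A l dim by auto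
      hence A: "A \<noteq> {}" "- A \<noteq> {}" by (auto simp: A_def)
      have card_cA: "real (card (- A)) = real d - real l"
        using card_A dim by (simp add: Compl_eq_Diff_UNIV card_Diff_subset of_nat_diff)
      have meas: "{Q. (\<Sum>i\<in>A. ((transpose Q *v v) $ i)\<^sup>2) \<le> a * (v \<bullet> v)} \<in> sets borel"
        by (intro borel_closed closed_Collect_le cont3 continuous_intros)
      have "prob {Q. (\<Sum>i\<in>A. ((transpose Q *v v) $ i)\<^sup>2) \<le> a * (v \<bullet> v)} =
        reg_inc_beta a (real l / 2) ((real d - real l) / 2)"
        using haar_orthogonal_projection[OF haar A False, of a]
        by (simp add: measure_def card_A card_cA reg_inc_beta_def cdf_def del: transpose_matrix_vector)
      \<comment> \<open>The distribution function controls the event with \<open>\<le>\<close>. Its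
        complement is the strict event, contained in the desired one, so a lower bound survives
        whatever the boundary weighs.\<close>
      hence "\<delta> \<le> 1 - prob {Q. (\<Sum>i\<in>A. ((transpose Q *v v) $ i)\<^sup>2) \<le> a * (v \<bullet> v)}"
        using large by (simp add: a_def)
      also have "\<dots> = prob (space \<mu> - {Q. (\<Sum>i\<in>A. ((transpose Q *v v) $ i)\<^sup>2) \<le> a * (v \<bullet> v)})"
        using meas by (subst prob_compl) (auto simp: sets_mu)
      also have "\<dots> \<le> prob {Q. (1 - \<epsilon>) * (v \<bullet> v) \<le> real d / real l * (\<Sum>i\<in>A. ((transpose Q *v v) $ i)\<^sup>2)}"
      proof (rule finite_measure_mono)
        show "{Q. (1 - \<epsilon>) * (v \<bullet> v) \<le> real d / real l * (\<Sum>i\<in>A. ((transpose Q *v v) $ i)\<^sup>2)} \<in> sets \<mu>"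
          unfolding sets_mu by (intro borel_closed closed_Collect_le cont3 continuous_intros)
        have "(1 - \<epsilon>) * (v \<bullet> v) \<le> real d / real l * s" if "\<not> s \<le> a * (v \<bullet> v)" for s
          using that ldpos unfolding a_def by (simp add: field_simps)
        thus "space \<mu> - {Q. (\<Sum>i\<in>A. ((transpose Q *v v) $ i)\<^sup>2) \<le> a * (v \<bullet> v)} \<subseteq>
          {Q. (1 - \<epsilon>) * (v \<bullet> v) \<le> real d / real l * (\<Sum>i\<in>A. ((transpose Q *v v) $ i)\<^sup>2)}"
          by blast
      qed
      finally show ?thesis .
    qed
  qed
  finally show "measure \<nu> {P. (1 - \<epsilon>) * (v \<bullet> v) \<le> (transpose P *v v) \<bullet> (transpose P *v v)} \<ge> \<delta>" .
qed

section \<open>Iterations driven by independent matrices\<close>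

text \<open>The iterate \<open>x j\<close> is a function of the matrices before index
  \<open>j\<close>, hence independent of \<open>P j\<close>. Their joint law is a product, so
  \<open>P j\<close> can be integrated out first with the iterate held fixed; this gains a factor
  \<open>q\<close> per step.\<close>

lemma nn_integral_iterate_le:
  fixes step :: "'a::second_countable_topology \<Rightarrow> 'b::second_countable_topology \<Rightarrow> 'a"
    and V :: "'a \<Rightarrow> ennreal"
  assumes "prob_space M"
    and indep: "prob_space.indep_vars M (\<lambda>_. borel) P UNIV"
    and law: "\<And>j. distr M borel (P j) = \<nu>"
    and step [measurable]: "(\<lambda>(y, p). step y p) \<in> borel_measurable (borel \<Otimes>\<^sub>M borel)"
    and V [measurable]: "V \<in> borel_measurable borel"
    and x_0: "\<And>\<omega>. \<omega> \<in> space M \<Longrightarrow> x 0 \<omega> = x0"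
    and x_Suc: "\<And>j \<omega>. \<omega> \<in> space M \<Longrightarrow> x (Suc j) \<omega> = step (x j \<omega>) (P j \<omega>)"
    and contract: "\<And>y. (\<integral>\<^sup>+p. V (step y p) \<partial>\<nu>) \<le> q * V y"
  shows "x k \<in> borel_measurable M" "(\<integral>\<^sup>+\<omega>. V (x k \<omega>) \<partial>M) \<le> q ^ k * V x0"
proof -
  interpret prob_space M by fact
  \<comment> \<open>The same recursion as a deterministic function of the sequence of
    matrices.\<close>
  define X where "X = rec_nat (\<lambda>_. x0) (\<lambda>j X p. step (X p) (p j))"
  have X_simps: "X 0 p = x0" "X (Suc j) p = step (X j p) (p j)" for j and p :: "nat \<Rightarrow> 'b"
    by (simp_all add: X_def)
  \<comment> \<open>The index set \<open>J\<close> stays fixed while \<open>j\<close> grows; with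
    \<open>{..<j}\<close> in its place the induction hypothesis would concern a different product
    space.\<close>
  have X_meas: "X j \<in> borel_measurable (Pi\<^sub>M J (\<lambda>_. borel))" if "{..<j} \<subseteq> J" for j J
    using that
  proof (induction j)
    case 0
    have "X 0 = (\<lambda>_. x0)" by (simp add: fun_eq_iff X_simps)
    thus ?case by simp
  next
    case (Suc j)
    have "X (Suc j) = (\<lambda>p. step (X j p) (p j))" by (simp add: fun_eq_iff X_simps)
    moreover have [measurable]: "X j \<in> borel_measurable (Pi\<^sub>M J (\<lambda>_. borel))"
      using Suc by (simp add: lessThan_Suc)
    moreover have [measurable]: "(\<lambda>p. p j) \<in> borel_measurable (Pi\<^sub>M J (\<lambda>_. borel :: 'b measure))"
      using Suc.prems by (intro measurable_component_singleton) auto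
    ultimately show ?case by simp
  qed
  have X_cong: "X j p = X j p'" if "\<And>i. i < j \<Longrightarrow> p i = p' i" for j p p'
    using that by (induction j) (simp_all add: X_simps)
  have x_eq: "x j \<omega> = X j (\<lambda>i. P i \<omega>)" if "\<omega> \<in> space M" for j \<omega>
    using that by (induction j) (simp_all add: X_simps x_0 x_Suc)
  have x_eq': "x j \<omega> = X j (\<lambda>i\<in>{..<j}. P i \<omega>)" if "\<omega> \<in> space M" for j \<omega>
    unfolding x_eq[OF that] by (rule X_cong) simp
  have P [measurable]: "P j \<in> borel_measurable M" for j
    using indep by (simp add: indep_vars_def)
  have x_meas [measurable]: "x j \<in> borel_measurable M" for j
  proof -
    have "(\<lambda>\<omega>. X j (\<lambda>i\<in>{..<j}. P i \<omega>)) \<in> borel_measurable M"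
      by (rule measurable_compose[OF _ X_meas[of j "{..<j}"]]) (auto intro!: measurable_restrict)
    thus ?thesis by (simp add: x_eq' cong: measurable_cong)
  qed
  show "x k \<in> borel_measurable M" by (rule x_meas)
  show "(\<integral>\<^sup>+\<omega>. V (x k \<omega>) \<partial>M) \<le> q ^ k * V x0"
  proof (induction k)
    case 0
    show ?case by (simp add: x_0 emeasure_space_1 cong: nn_integral_cong)
  next
    case (Suc j)
    \<comment> \<open>\<open>indep_var\<close> wants both variables to have the same type, hence a singleton family for \<open>P j\<close>.\<close>
    define past where "past \<omega> = (\<lambda>i\<in>{..<j}. P i \<omega>)" for \<omega>
    define next_P where "next_P \<omega> = (\<lambda>i\<in>{j}. P i \<omega>)" for \<omega>
    define S where "S = (Pi\<^sub>M {..<j} (\<lambda>_. borel) :: (nat \<Rightarrow> 'b) measure)"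
    define T where "T = (Pi\<^sub>M {j} (\<lambda>_. borel) :: (nat \<Rightarrow> 'b) measure)"
    have indep_past: "indep_var S past T next_P"
      unfolding S_def T_def past_def next_P_def by (rule indep_var_restrict[OF indep]) auto
    have [measurable]: "past \<in> M \<rightarrow>\<^sub>M S" "next_P \<in> M \<rightarrow>\<^sub>M T"
      using indep_past by (simp_all add: indep_var_distribution_eq)
    have [measurable]: "X j \<in> borel_measurable S" unfolding S_def by (rule X_meas) simp
    have [measurable]: "(\<lambda>p. p j) \<in> borel_measurable T"
      unfolding T_def by (rule measurable_component_singleton) simp
    interpret next_P: prob_space "distr M T next_P" by (rule prob_space_distr) measurable
    have next_P_j: "next_P \<omega> j = P j \<omega>" for \<omega> by (simp add: next_P_def)
    have "(\<integral>\<^sup>+\<omega>. V (x (Suc j) \<omega>) \<partial>M) = (\<integral>\<^sup>+\<omega>. V (step (X j (past \<omega>)) (next_P \<omega> j)) \<partial>M)"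
      by (intro nn_integral_cong) (simp add: x_Suc x_eq'[of _ j] past_def next_P_j)
    also have "\<dots> = (\<integral>\<^sup>+z. V (step (X j (fst z)) (snd z j)) \<partial>distr M (S \<Otimes>\<^sub>M T) (\<lambda>\<omega>. (past \<omega>, next_P \<omega>)))"
      by (subst nn_integral_distr) auto
    also have "distr M (S \<Otimes>\<^sub>M T) (\<lambda>\<omega>. (past \<omega>, next_P \<omega>)) = distr M S past \<Otimes>\<^sub>M distr M T next_P"
      using indep_past by (simp add: indep_var_distribution_eq)
    also have "(\<integral>\<^sup>+z. V (step (X j (fst z)) (snd z j)) \<partial>(distr M S past \<Otimes>\<^sub>M distr M T next_P)) =
        (\<integral>\<^sup>+p. \<integral>\<^sup>+p'. V (step (X j p) (p' j)) \<partial>distr M T next_P \<partial>distr M S past)"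
      by (subst next_P.nn_integral_fst[symmetric]) auto
    also have "\<dots> = (\<integral>\<^sup>+p. \<integral>\<^sup>+p'. V (step (X j p) p') \<partial>\<nu> \<partial>distr M S past)"
    proof (rule nn_integral_cong)
      fix p
      have "(\<integral>\<^sup>+p'. V (step (X j p) (p' j)) \<partial>distr M T next_P) = (\<integral>\<^sup>+\<omega>. V (step (X j p) (P j \<omega>)) \<partial>M)"
        by (subst nn_integral_distr) (auto simp: next_P_j)
      also have "\<dots> = (\<integral>\<^sup>+p'. V (step (X j p) p') \<partial>\<nu>)"
        by (subst law[of j, symmetric], subst nn_integral_distr) auto
      finally show "(\<integral>\<^sup>+p'. V (step (X j p) (p' j)) \<partial>distr M T next_P) = (\<integral>\<^sup>+p'. V (step (X j p) p') \<partial>\<nu>)" .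
    qed
    also have "\<dots> \<le> (\<integral>\<^sup>+p. q * V (X j p) \<partial>distr M S past)"
      by (intro nn_integral_mono contract)
    also have "\<dots> = q * (\<integral>\<^sup>+\<omega>. V (X j (past \<omega>)) \<partial>M)"
      by (subst nn_integral_distr) (auto simp: nn_integral_cmult)
    also have "(\<integral>\<^sup>+\<omega>. V (X j (past \<omega>)) \<partial>M) = (\<integral>\<^sup>+\<omega>. V (x j \<omega>) \<partial>M)"
      by (intro nn_integral_cong) (simp add: x_eq' past_def)
    also have "q * \<dots> \<le> q * (q ^ j * V x0)" by (intro mult_left_mono Suc) simp
    finally show ?case by (simp add: mult.assoc)
  qed
qed

text \<open>With \<open>w = transpose P *v f' y\<close>, adjointness gives
  \<open>w \<bullet> w\<close> as the inner product of the gradient and the direction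
  \<open>P *v w\<close>, and the frame condition gives \<open>c * (w \<bullet> w)\<close> as the
  squared length of the direction. By \<open>lam * \<alpha> * c = 1\<close> the quadratic term
  cancels half of the linear decrease.\<close>

lemma sketched_gradient_step:
  fixes f :: "real ^ 'd \<Rightarrow> real" and P :: "real ^ 'l ^ 'd"
  assumes descent: "\<And>y z. f z \<le> f y + f' y \<bullet> (z - y) + lam / 2 * (norm (z - y))\<^sup>2"
    and frame: "transpose P ** P = c *\<^sub>R mat 1" and step: "lam * \<alpha> * c = 1"
  shows "f (y - \<alpha> *\<^sub>R ((P ** transpose P) *v f' y)) \<le>
    f y - \<alpha> / 2 * ((transpose P *v f' y) \<bullet> (transpose P *v f' y))"
proof -
  define w where "w = transpose P *v f' y"
  have PP: "(P ** transpose P) *v f' y = P *v w"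
    by (simp only: w_def matrix_vector_mul_assoc)
  have adj: "u \<bullet> (P *v w) = (transpose P *v u) \<bullet> w" for u
    by (metis dot_lmul_matrix transpose_matrix_vector)
  have "(norm (P *v w))\<^sup>2 = (transpose P *v (P *v w)) \<bullet> w"
    by (simp only: power2_norm_eq_inner adj)
  also have "\<dots> = c * (w \<bullet> w)"
    by (simp only: matrix_vector_mul_assoc frame) (simp add: scaleR_matrix_vector_assoc[symmetric])
  finally have norm_Pw: "(norm (P *v w))\<^sup>2 = c * (w \<bullet> w)" .
  have "f (y - \<alpha> *\<^sub>R (P *v w)) \<le> f y - \<alpha> * (w \<bullet> w) + lam / 2 * (\<alpha>\<^sup>2 * (c * (w \<bullet> w)))"
    using descent[of "y - \<alpha> *\<^sub>R (P *v w)" y]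
    by (simp add: adj w_def[symmetric] power_mult_distrib norm_Pw del: transpose_matrix_vector)
  also have "lam / 2 * (\<alpha>\<^sup>2 * (c * (w \<bullet> w))) = (lam * \<alpha> * c) * (\<alpha> / 2 * (w \<bullet> w))"
    by (simp add: power2_eq_square)
  finally show ?thesis
    unfolding PP w_def[symmetric] step by simp
qed

text \<open>The mean of the two-level bound decreases in the probability of \<open>A\<close>,
  because \<open>b \<le> 1\<close>; hence that probability may be replaced by its lower bound
  \<open>\<delta>\<close>.\<close>

lemma nn_integral_two_level_le:
  assumes "prob_space \<nu>" and A: "A \<in> sets \<nu>" "\<delta> \<le> measure \<nu> A"
    and "0 \<le> b" "b \<le> 1" "0 \<le> v"
    and u: "AE p in \<nu>. u p \<le> (if p \<in> A then b * v else v)"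
  shows "(\<integral>\<^sup>+p. ennreal (u p) \<partial>\<nu>) \<le> ennreal ((1 - \<delta> + \<delta> * b) * v)"
proof -
  interpret prob_space \<nu> by fact
  have "(\<integral>\<^sup>+p. ennreal (u p) \<partial>\<nu>) \<le> (\<integral>\<^sup>+p. ennreal (b * v) * indicator A p + ennreal v * indicator (space \<nu> - A) p \<partial>\<nu>)"
  proof (rule nn_integral_mono_AE, use u AE_space in eventually_elim)
    case (elim p)
    thus ?case by (auto simp: indicator_def intro: ennreal_leI)
  qed
  also have "\<dots> = ennreal (b * v) * ennreal (prob A) + ennreal v * ennreal (prob (space \<nu> - A))"
    using A by (subst nn_integral_add) (auto simp: nn_integral_cmult_indicator emeasure_eq_measure)
  also have "\<dots> = ennreal (b * v * prob A + v * (1 - prob A))"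
    using A \<open>0 \<le> b\<close> \<open>0 \<le> v\<close> by (simp add: prob_compl ennreal_mult ennreal_plus)
  also have "\<dots> \<le> ennreal ((1 - \<delta> + \<delta> * b) * v)"
  proof (rule ennreal_leI)
    have "0 \<le> (prob A - \<delta>) * ((1 - b) * v)" using assms by (intro mult_nonneg_nonneg) auto
    thus "b * v * prob A + v * (1 - prob A) \<le> (1 - \<delta> + \<delta> * b) * v" by (simp add: algebra_simps)
  qed
  finally show ?thesis .
qed

section \<open>The tail bound for sketched gradient descent\<close>

theorem theorem4:
  fixes f :: "'d::{finite,linorder} rvec \<Rightarrow> real"
    and f' :: "'d rvec \<Rightarrow> 'd rvec"
    and lam \<gamma> f_min \<epsilon> \<delta> \<alpha> \<rho> t :: real
    and x0 :: "'d rvec"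
    and d l k :: nat
    and M :: "'w measure"
    and \<mu> :: "('d, 'd) rmat measure"
    and P :: "nat \<Rightarrow> 'w \<Rightarrow> ('d, 'l::{finite,linorder}) rmat"
    and x :: "nat \<Rightarrow> 'w \<Rightarrow> 'd rvec"
  assumes gradient: "\<And>y. GDERIV f y :> f' y"
    and continuous_gradient: "continuous_on UNIV f'"
    and lipschitz_gradient: "lam-lipschitz_on UNIV f'"
    and gamma_pos: "\<gamma> > 0"
    and strongly_convex:
      "\<And>y z. f z \<ge> f y + f' y \<bullet> (z - y) + \<gamma> / 2 * (norm (z - y))\<^sup>2"
    and minimum: "f_min \<in> range f" "\<And>y. f_min \<le> f y"
    and x0_not_minimizer: "f x0 \<noteq> f_min"
    and eps: "0 < \<epsilon>" "\<epsilon> < 1"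
    and delta: "0 < \<delta>" "\<delta> \<le> 1"
    and dimensions: "d = CARD('d)" "l = CARD('l)" "1 \<le> l" "l \<le> d"
    and l_large:
      "1 - reg_inc_beta ((1 - \<epsilon>) * real l / real d) (real l / 2) ((real d - real l) / 2) \<ge> \<delta>"
    and prob_space: "prob_space M"
    and haar: "haar_orthogonal \<mu>"
    and independent: "prob_space.indep_vars M (\<lambda>_. borel) P UNIV"
    and distribution:
      "\<And>j. distr M borel (P j) =
        distr \<mu> borel (\<lambda>Q. sqrt (real d / real l) *\<^sub>R (Q ** id_columns))"
    and step_size: "\<alpha> = real l / (real d * lam)"
    and x_0: "\<And>\<omega>. \<omega> \<in> space M \<Longrightarrow> x 0 \<omega> = x0"
    and x_Suc: "\<And>j \<omega>. \<omega> \<in> space M \<Longrightarrow>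
      x (Suc j) \<omega> = x j \<omega> - \<alpha> *\<^sub>R ((P j \<omega> ** transpose (P j \<omega>)) *v f' (x j \<omega>))"
    and t: "0 < t" "t \<le> \<delta>"
    and rho: "\<rho> = (1 - (1 - \<epsilon>) * (real l * \<gamma> / (real d * lam))) powr (\<delta> - t)"
    and k: "k \<ge> 1"
  shows "measure M {\<omega> \<in> space M. f (x k \<omega>) - f_min \<ge> \<rho> ^ k * (f x0 - f_min)}
    \<le> (if \<delta> = 1 then 0 else exp (- ((real k * t)\<^sup>2 / (2 * sigma_sq \<delta> k))))"
proof -
  note prob_M = prob_space
  interpret prob_space M by (rule prob_M)
  define \<nu> where "\<nu> = distr \<mu> borel (\<lambda>Q. sqrt (real d / real l) *\<^sub>R (Q ** (id_columns :: ('d, 'l) rmat)))"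
  define step where "step y p = y - \<alpha> *\<^sub>R ((p ** transpose p) *v f' y)" for y and p :: "('d, 'l) rmat"
  define F where "F y = (f y - f_min) / (f x0 - f_min)" for y
  define \<kappa> where "\<kappa> = real l * \<gamma> / (real d * lam)"
  define c where "c = 1 - (1 - \<epsilon>) * \<kappa>"
  define bad where "bad = {\<omega> \<in> space M. f (x k \<omega>) - f_min \<ge> \<rho> ^ k * (f x0 - f_min)}"

  have ld: "real l > 0" "real d > 0" "real l \<le> real d" using dimensions by auto
  have "\<gamma> \<le> lam"
    by (rule strong_convexity_le_smoothness[OF gradient lipschitz_gradient strongly_convex])
  hence lam: "lam > 0" using gamma_pos by simp
  have \<alpha>: "\<alpha> > 0" "lam * \<alpha> * (real d / real l) = 1" "\<alpha> * \<gamma> = \<kappa>"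
    using ld lam by (simp_all add: step_size \<kappa>_def)
  have \<kappa>: "0 < \<kappa>" "\<kappa> \<le> 1"
    using ld lam gamma_pos \<open>\<gamma> \<le> lam\<close> by (auto simp: \<kappa>_def intro!: mult_mono)
  have "(1 - \<epsilon>) * \<kappa> < 1 * 1" using \<kappa> eps by (intro mult_less_le_imp_less) auto
  moreover have "(1 - \<epsilon>) * \<kappa> > 0" using \<kappa> eps by simp
  ultimately have c: "0 < c" "c < 1" by (simp_all add: c_def)
  \<comment> \<open>This makes the relative excess \<open>F\<close> meaningful. From a minimizer the
    event in question would be certain.\<close>
  have fx0: "f x0 - f_min > 0"
    using x0_not_minimizer minimum(2)[of x0] by simp
  have F_nonneg: "F y \<ge> 0" for y using minimum(2)[of y] fx0 by (simp add: F_def)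

  have cont_f: "continuous_on UNIV f"
    using gradient unfolding gderiv_def
    by (intro continuous_at_imp_continuous_on) (blast intro: has_derivative_continuous)
  have [measurable]: "f \<in> borel_measurable borel" "f' \<in> borel_measurable borel"
    using cont_f continuous_gradient by (auto intro: borel_measurable_continuous_onI)
  have [measurable]: "F \<in> borel_measurable borel" unfolding F_def by measurable
  have "continuous_on UNIV (\<lambda>(g :: 'd rvec, p :: ('d, 'l) rmat). (p ** transpose p) *v g)"
    unfolding matrix_vector_mult_def matrix_matrix_mult_def transpose_def split_beta
    by (auto intro!: continuous_intros)
  hence [measurable]: "(\<lambda>(g :: 'd rvec, p :: ('d, 'l) rmat). (p ** transpose p) *v g) \<in> borel_measurable (borel \<Otimes>\<^sub>M borel)"
    using borel_measurable_continuous_onI by (simp add: borel_prod)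
  have step_meas: "(\<lambda>(y, p). step y p) \<in> borel_measurable (borel \<Otimes>\<^sub>M borel)"
    unfolding step_def by measurable
  have cont_proj: "continuous_on UNIV (\<lambda>p :: ('d, 'l) rmat. (transpose p *v v) \<bullet> (transpose p *v v))" for v
    unfolding matrix_vector_mult_def transpose_def by (auto intro!: continuous_intros)

  have nu: "prob_space \<nu>"
  proof -
    have "P 0 \<in> borel_measurable M" using independent by (simp add: indep_vars_def)
    thus ?thesis unfolding \<nu>_def using distribution[of 0] prob_space_distr by metis
  qed
  have frame: "AE p in \<nu>. transpose p ** p = (real d / real l) *\<^sub>R mat 1"
    and large: "\<And>v. \<delta> \<le> measure \<nu> {p. (1 - \<epsilon>) * (v \<bullet> v) \<le> (transpose p *v v) \<bullet> (transpose p *v v)}"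
    unfolding \<nu>_def
    by (rule haar_scaled_columns(1)[OF haar dimensions(1,2,4)],
        rule haar_scaled_columns(2)[OF haar dimensions(1,2,4) _ l_large delta(2)])
      (use eps in simp)

  have step_le: "F (step y p) \<le> (if p \<in> {p. (1 - \<epsilon>) * (f' y \<bullet> f' y) \<le> (transpose p *v f' y) \<bullet> (transpose p *v f' y)} then c * F y else F y)"
    if "transpose p ** p = (real d / real l) *\<^sub>R mat 1" for y p
  proof -
    define w where "w = (transpose p *v f' y) \<bullet> (transpose p *v f' y)"
    have descent: "f (step y p) \<le> f y - \<alpha> / 2 * w"
      unfolding step_def w_def
      by (rule sketched_gradient_step[OF smooth_descent[OF gradient lipschitz_gradient] that \<alpha>(2)])
    moreover have "w \<ge> 0" by (simp add: w_def)
    hence "\<alpha> / 2 * w \<ge> 0" using \<alpha>(1) by simp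
    ultimately have "f (step y p) \<le> f y" by linarith
    hence le: "F (step y p) \<le> F y" using fx0 by (simp add: F_def divide_right_mono)
    have "F (step y p) \<le> c * F y" if "(1 - \<epsilon>) * (f' y \<bullet> f' y) \<le> w"
    proof -
      obtain z where "f_min = f z" using minimum(1) by blast
      hence PL: "2 * \<gamma> * (f y - f_min) \<le> f' y \<bullet> f' y"
        using strongly_convex_gradient_dominated[OF gamma_pos strongly_convex, of y z]
        by (simp add: power2_norm_eq_inner)
      \<comment> \<open>As \<open>\<alpha> * \<gamma> = \<kappa>\<close>, gradient domination turns
        a fraction \<open>1 - \<epsilon>\<close> of the squared gradient into a fraction
        \<open>(1 - \<epsilon>) * \<kappa>\<close> of the excess.\<close>
      have "(1 - \<epsilon>) * \<kappa> * (f y - f_min) = \<alpha> / 2 * ((1 - \<epsilon>) * (2 * \<gamma> * (f y - f_min)))"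
        by (simp add: \<alpha>(3)[symmetric])
      also have "\<dots> \<le> \<alpha> / 2 * ((1 - \<epsilon>) * (f' y \<bullet> f' y))"
        using PL \<alpha>(1) eps by (intro mult_left_mono) auto
      also have "\<dots> \<le> \<alpha> / 2 * w" using that \<alpha>(1) by (intro mult_left_mono) auto
      finally have "f (step y p) - f_min \<le> c * (f y - f_min)"
        using descent by (simp add: c_def algebra_simps)
      thus ?thesis using fx0 by (simp add: F_def divide_right_mono)
    qed
    with le show ?thesis by (simp add: w_def)
  qed

  have tail: "prob bad \<le> exp (s * (\<delta> - t) * real k) * (1 - \<delta> + \<delta> * exp (- s)) ^ k" if "s > 0" for s
  proof -
    \<comment> \<open>The exponent for which \<open>c powr r = exp (- s)\<close>; a good step then
      multiplies \<open>V\<close> by at most \<open>exp (- s)\<close>, and \<open>s\<close> is the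
      free parameter of a Chernoff bound.\<close>
    define r where "r = - s / ln c"
    have r: "r > 0" using c that by (simp add: r_def divide_pos_neg)
    have c_powr: "c powr r = exp (- s)" using c by (simp add: r_def powr_def)
    define V where "V y = ennreal (F y powr r)" for y
    have [measurable]: "V \<in> borel_measurable borel" unfolding V_def by measurable
    define q where "q = 1 - \<delta> + \<delta> * exp (- s)"
    have q: "q \<ge> 0" using delta by (simp add: q_def)
    have contract: "(\<integral>\<^sup>+p. V (step y p) \<partial>\<nu>) \<le> ennreal q * V y" for y
    proof -
      define A where "A = {p :: ('d, 'l) rmat. (1 - \<epsilon>) * (f' y \<bullet> f' y) \<le> (transpose p *v f' y) \<bullet> (transpose p *v f' y)}"
      have "A \<in> sets borel" unfolding A_def
        by (intro borel_closed closed_Collect_le cont_proj continuous_intros)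
      hence "A \<in> sets \<nu>" by (simp add: \<nu>_def)
      have "(\<integral>\<^sup>+p. ennreal (F (step y p) powr r) \<partial>\<nu>) \<le> ennreal ((1 - \<delta> + \<delta> * exp (- s)) * F y powr r)"
      proof (rule nn_integral_two_level_le[OF nu \<open>A \<in> sets \<nu>\<close>])
        show "\<delta> \<le> measure \<nu> A" unfolding A_def by (rule large)
        show "AE p in \<nu>. F (step y p) powr r \<le> (if p \<in> A then exp (- s) * F y powr r else F y powr r)"
          using frame
        proof eventually_elim
          case (elim p)
          have "F (step y p) powr r \<le> (if p \<in> A then c * F y else F y) powr r"
            using step_le[OF elim, of y] r F_nonneg unfolding A_def by (intro powr_mono2) auto
          thus ?case using c F_nonneg by (auto simp: powr_mult c_powr split: if_splits)
        qed
      qed (use that in auto)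
      thus ?thesis using q by (simp add: V_def q_def ennreal_mult)
    qed
    note iterate = nn_integral_iterate_le[where V = V and step = step and x = x and k = k,
        OF prob_M independent distribution[folded \<nu>_def] step_meas _ x_0 _ contract]
    have x_meas [measurable]: "x k \<in> borel_measurable M"
      by (rule iterate(1)) (auto simp: step_def x_Suc)
    have "(\<integral>\<^sup>+\<omega>. V (x k \<omega>) \<partial>M) \<le> ennreal q ^ k * V x0"
      by (rule iterate(2)) (auto simp: step_def x_Suc)
    also have "V x0 = 1" using fx0 by (simp add: V_def F_def)
    finally have EV: "(\<integral>\<^sup>+\<omega>. V (x k \<omega>) \<partial>M) \<le> ennreal (q ^ k)"
      using q by (simp add: ennreal_power)
    define e where "e = exp (s * (\<delta> - t) * real k)"
    \<comment> \<open>Since \<open>\<rho> = c powr (\<delta> - t)\<close>, the threshold in terms of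
      \<open>V\<close> is \<open>exp (- (s * (\<delta> - t) * k))\<close>; its reciprocal
      \<open>e\<close> is the factor in Markov's inequality.\<close>
    have \<rho>: "(\<rho> ^ k) powr r = 1 / e" "\<rho> > 0"
    proof -
      have \<rho>_eq: "\<rho> = c powr (\<delta> - t)" by (simp add: rho c_def \<kappa>_def)
      show "\<rho> > 0" using c by (simp add: \<rho>_eq)
      hence "(\<rho> ^ k) powr r = (c powr r) powr ((\<delta> - t) * real k)"
        by (simp add: \<rho>_eq powr_powr mult_ac flip: powr_realpow)
      also have "\<dots> = exp (- (s * (\<delta> - t) * real k))"
        by (simp add: c_powr exp_powr_real algebra_simps)
      finally show "(\<rho> ^ k) powr r = 1 / e" by (simp add: e_def exp_minus inverse_eq_divide)
    qed
    have "bad \<subseteq> {\<omega> \<in> space M. 1 \<le> ennreal e * V (x k \<omega>)}"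
    proof
      fix \<omega> assume "\<omega> \<in> bad"
      hence \<omega>: "\<omega> \<in> space M" "\<rho> ^ k \<le> F (x k \<omega>)"
        using fx0 by (simp_all add: bad_def F_def pos_le_divide_eq)
      hence "(\<rho> ^ k) powr r \<le> F (x k \<omega>) powr r"
        using \<rho>(2) r by (intro powr_mono2) auto
      hence "1 \<le> e * F (x k \<omega>) powr r" by (simp add: \<rho>(1) e_def field_simps)
      thus "\<omega> \<in> {\<omega> \<in> space M. 1 \<le> ennreal e * V (x k \<omega>)}"
        using \<omega>(1) by (simp add: V_def ennreal_mult[symmetric] e_def)
    qed
    moreover have "{\<omega> \<in> space M. 1 \<le> ennreal e * V (x k \<omega>)} \<in> sets M" by measurable
    ultimately have "emeasure M bad \<le> emeasure M {\<omega> \<in> space M. 1 \<le> ennreal e * V (x k \<omega>)}"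
      by (rule emeasure_mono)
    also have "\<dots> \<le> ennreal e * (\<integral>\<^sup>+\<omega>. V (x k \<omega>) * indicator (space M) \<omega> \<partial>M)"
      by (rule nn_integral_Markov_inequality) auto
    also have "(\<integral>\<^sup>+\<omega>. V (x k \<omega>) * indicator (space M) \<omega> \<partial>M) = (\<integral>\<^sup>+\<omega>. V (x k \<omega>) \<partial>M)"
      by (intro nn_integral_cong) simp
    also have "ennreal e * \<dots> \<le> ennreal e * ennreal (q ^ k)" by (intro mult_left_mono EV) simp
    also have "\<dots> = ennreal (e * q ^ k)" using q by (simp add: ennreal_mult e_def)
    finally show ?thesis
      using q by (simp add: emeasure_eq_measure e_def q_def)
  qed

  have "prob bad \<le> (if \<delta> = 1 then 0 else exp (- ((real k * t)\<^sup>2 / (2 * sigma_sq \<delta> k))))"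
  proof (cases "\<delta> = 1")
    case True
    \<comment> \<open>At \<open>\<delta> = 1\<close> the mean factor is \<open>exp (- s)\<close>, so
      the exponents combine to \<open>- s * t * k\<close>, with \<open>s\<close> arbitrarily
      large.\<close>
    have "prob bad \<le> exp (- (s * (t * real k)))" if "s > 0" for s
      using tail[OF that] True by (simp add: exp_of_nat_mult[symmetric] exp_add[symmetric] algebra_simps)
    hence bound: "eventually (\<lambda>s. prob bad \<le> exp (- (s * (t * real k)))) at_top"
      by (rule eventually_at_top_linorderI[where c=1, OF _]) auto
    have "((\<lambda>s. exp (- (s * (t * real k)))) \<longlongrightarrow> 0) at_top"
    proof -
      have "t * real k > 0" using t k by simp
      hence "filterlim (\<lambda>s. s * (t * real k)) at_top at_top"
        by (intro filterlim_at_top_mult_tendsto_pos[OF tendsto_const] filterlim_ident)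
      hence "filterlim (\<lambda>s. - (s * (t * real k))) at_bot at_top"
        by (rule filterlim_uminus_at_bot_at_top[THEN filterlim_compose])
      thus ?thesis by (rule filterlim_compose[OF exp_at_bot])
    qed
    from tendsto_lowerbound[OF this bound] have "prob bad \<le> 0" by simp
    thus ?thesis using True by simp
  next
    case False
    hence \<delta>: "0 < \<delta>" "\<delta> < 1" using delta by auto
    define v where "v = sigma_sq \<delta> 1"
    have v: "v > 0" unfolding v_def by (rule sigma_sq_pos[OF \<delta>])
    \<comment> \<open>The minimizer of \<open>s\<^sup>2 * v / 2 - s * t\<close>, with minimum
      \<open>- t\<^sup>2 / (2 * v)\<close>. The moment bound is then applied at
      \<open>- s\<close>.\<close>
    define s where "s = t / v"
    have s: "s > 0" using t v by (simp add: s_def)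
    have "prob bad \<le> exp (s * (\<delta> - t) * real k) * (1 - \<delta> + \<delta> * exp (- s)) ^ k" by (rule tail[OF s])
    also have "\<dots> \<le> exp (s * (\<delta> - t) * real k) * exp (- s * \<delta> + (- s)\<^sup>2 * v / 2) ^ k"
      unfolding v_def using delta
      by (intro mult_left_mono power_mono bernoulli_exp_moment_le[OF \<delta>]) auto
    also have "\<dots> = exp (real k * (s\<^sup>2 * v / 2 - s * t))"
      by (simp add: exp_of_nat_mult[symmetric] exp_add[symmetric] algebra_simps)
    also have "real k * (s\<^sup>2 * v / 2 - s * t) = - ((real k * t)\<^sup>2 / (2 * (real k * v)))"
      using v k by (simp add: s_def field_simps power2_eq_square)
    also have "real k * v = sigma_sq \<delta> k" unfolding v_def by (rule sigma_sq_eq[symmetric])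
    finally show ?thesis using False by simp
  qed
  thus ?thesis by (simp only: bad_def)
qed

end
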